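(* If $G$ is a minor minimal not apex (MMNA) graph, then $\kappa(G)\le 5$.
   Context: Graphs are finite, simple, undirected and have at least one vertex. A graph $H$ is a minor of $G$ if $H$ can be obtained by contracting edges in a subgraph of $G$ (after a contraction, doubled edges are replaced by a single edge so that the graph stays simple); a minor of $G$ is proper if it is not $G$ itself. $G-v$ is the graph obtained by deleting the vertex $v$ and its incident edges. A graph $G$ is not apex (NA) if $G-v$ is nonplanar for every vertex $v$. A graph is MMNA (minor minimal NA) if it is NA and no proper minor of it is NA. A $k$-cut is a set of $k$ vertices whose deletion leaves a disconnected graph. The connectivity $\kappa(G)$ is the largest integer $k$ such that $|V(G)|>k$ and $G$ has no $l$-cut with $l<k$ (so $\kappa(K_n)=n-1$). *)

theory Defs
  imports "HOL-Analysis.Analysis" "Graph_Theory.Digraph_Component"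
begin

text \<open>
  A finite simple undirected graph is a \<^locale>\<open>pair_graph\<close>: finite, loop-free, and with a
  symmetric arc relation, so that the edge \<open>uv\<close> is represented by both arcs \<open>(u, v)\<close>
  and \<open>(v, u)\<close>.
\<close>

definition simple_graph :: "'a pair_pre_digraph \<Rightarrow> bool" where
  "simple_graph G \<longleftrightarrow> pair_graph G \<and> pverts G \<noteq> {}"

text \<open>
  Planarity is topological: distinct points of the plane for the vertices, and for every edge
  an arc between its ends. Arcs are indexed by the unordered pair \<open>{u, v}\<close>, so the two
  orientations of an edge share one arc. An arc meets no vertex but its own ends, and two arcs
  meet only in common ends. The graph without vertices, which arises as \<open>G - v\<close> when \<open>v\<close> is
  the only vertex of \<open>G\<close>, counts as planar.
\<close>

definition plane_drawing ::
    "('a, 'b) pre_digraph \<Rightarrow> ('a \<Rightarrow> complex) \<Rightarrow> ('a set \<Rightarrow> real \<Rightarrow> complex) \<Rightarrow> bool" where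
  "plane_drawing G p \<gamma> \<longleftrightarrow>
     inj_on p (verts G) \<and>
     (\<forall>(u, v) \<in> arcs_ends G.
        arc (\<gamma> {u, v}) \<and>
        {pathstart (\<gamma> {u, v}), pathfinish (\<gamma> {u, v})} = {p u, p v} \<and>
        path_image (\<gamma> {u, v}) \<inter> p ` verts G = {p u, p v}) \<and>
     (\<forall>(u, v) \<in> arcs_ends G. \<forall>(x, y) \<in> arcs_ends G.
        {u, v} \<noteq> {x, y} \<longrightarrow>
        path_image (\<gamma> {u, v}) \<inter> path_image (\<gamma> {x, y}) \<subseteq> p ` ({u, v} \<inter> {x, y}))"

definition planar :: "('a, 'b) pre_digraph \<Rightarrow> bool" where
  "planar G \<longleftrightarrow> (\<exists>p \<gamma>. plane_drawing G p \<gamma>)"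

definition not_apex :: "'a pair_pre_digraph \<Rightarrow> bool" where
  "not_apex G \<longleftrightarrow> (\<forall>v \<in> pverts G. \<not> planar (pre_digraph.del_vert (with_proj G) v))"

text \<open>
  Contracting the edge \<open>uv\<close> redirects every edge at \<open>v\<close> to \<open>u\<close>, which serves as the merged
  vertex. The arc relation is a set, so doubled edges coincide, and the edge \<open>uv\<close> itself
  disappears because of \<open>x \<noteq> y\<close>.
\<close>

definition contract_edge :: "'a pair_pre_digraph \<Rightarrow> 'a \<Rightarrow> 'a \<Rightarrow> 'a pair_pre_digraph" where
  "contract_edge G u v =
     \<lparr> pverts = pverts G - {v},
       parcs = {(x, y). x \<noteq> y \<and>
                  (\<exists>(a, b) \<in> parcs G. x = (if a = v then u else a) \<and> y = (if b = v then u else b))} \<rparr>"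

definition contracts_to :: "'a pair_pre_digraph \<Rightarrow> 'a pair_pre_digraph \<Rightarrow> bool" where
  "contracts_to G H \<longleftrightarrow> (\<exists>(u, v) \<in> parcs G. H = contract_edge G u v)"

definition is_minor :: "'a pair_pre_digraph \<Rightarrow> 'a pair_pre_digraph \<Rightarrow> bool" where
  "is_minor H G \<longleftrightarrow>
     (\<exists>K. simple_graph K \<and> subgraph (with_proj K) (with_proj G) \<and> contracts_to\<^sup>*\<^sup>* K H)"

text \<open>
  Minors are taken up to equality of labelled graphs. A minor of the finite graph \<open>G\<close> obtained
  by at least one deletion or contraction is smaller than \<open>G\<close>
  (lemma \<open>proper_minor_smaller\<close> below), hence not isomorphic to \<open>G\<close>, so \<open>H \<noteq> G\<close>
  says the same as \<open>H\<close> not being isomorphic to \<open>G\<close>.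
\<close>

definition MMNA :: "'a pair_pre_digraph \<Rightarrow> bool" where
  "MMNA G \<longleftrightarrow>
     simple_graph G \<and> not_apex G \<and> (\<forall>H. is_minor H G \<and> H \<noteq> G \<longrightarrow> \<not> not_apex H)"

text \<open>
  A disconnected graph has at least one vertex; the library's \<^const>\<open>Digraph_Component.connected\<close>
  is false for the graph without vertices, which is therefore excluded.
\<close>

definition has_cut :: "'a pair_pre_digraph \<Rightarrow> nat \<Rightarrow> bool" where
  "has_cut G k \<longleftrightarrow>
     (\<exists>S \<subseteq> pverts G. card S = k \<and> pverts G - S \<noteq> {} \<and>
        \<not> Digraph_Component.connected (with_proj G \<restriction> (pverts G - S)))"

definition connectivity :: "'a pair_pre_digraph \<Rightarrow> nat" where
  "connectivity G = Max {k. k < card (pverts G) \<and> (\<forall>l<k. \<not> has_cut G l)}"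

lemma pair_graph_contract_edge:
  assumes "pair_graph G" "(u, v) \<in> parcs G"
  shows "pair_graph (contract_edge G u v)"
proof -
  interpret pair_graph G by fact
  have uv: "u \<noteq> v" "u \<in> pverts G"
    using assms(2) no_loops' in_arcsD1 by auto
  have wf: "x \<in> pverts G \<and> y \<in> pverts G" if "(x, y) \<in> parcs G" for x y
    using that in_arcsD1 in_arcsD2 by blast
  have symG: "(y, x) \<in> parcs G" if "(x, y) \<in> parcs G" for x y
    using that arcs_symmetric by blast
  have sub: "parcs (contract_edge G u v) \<subseteq> (pverts G - {v}) \<times> (pverts G - {v})"
    using uv wf by (fastforce simp: contract_edge_def split: if_splits)
  have "sym (parcs (contract_edge G u v))"
  proof (rule symI)
    fix x y assume "(x, y) \<in> parcs (contract_edge G u v)"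
    then obtain a b where "x \<noteq> y" "(a, b) \<in> parcs G"
      "x = (if a = v then u else a)" "y = (if b = v then u else b)"
      by (auto simp: contract_edge_def)
    moreover from this have "(b, a) \<in> parcs G" using symG by blast
    ultimately show "(y, x) \<in> parcs (contract_edge G u v)"
      unfolding contract_edge_def by (auto intro!: bexI[of _ "(b, a)"])
  qed
  moreover have "finite (pverts G)" by (rule pair_finite_verts)
  moreover from this have "finite (parcs (contract_edge G u v))"
    using sub by (meson finite_Diff finite_SigmaI finite_subset)
  moreover have "pverts (contract_edge G u v) = pverts G - {v}"
    "e \<in> parcs (contract_edge G u v) \<Longrightarrow> fst e \<noteq> snd e" for e
    by (auto simp: contract_edge_def)
  ultimately show ?thesis
    using sub by unfold_locales (auto simp: symmetric_def)
qed

lemma contracts_to_smaller: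
  assumes "simple_graph G" "contracts_to G H"
  shows "simple_graph H \<and> card (pverts H) < card (pverts G)"
proof -
  interpret pair_graph G using assms(1) by (simp add: simple_graph_def)
  obtain u v where uv: "(u, v) \<in> parcs G" "H = contract_edge G u v"
    using assms(2) by (auto simp: contracts_to_def)
  have "u \<in> pverts G" "v \<in> pverts G" "u \<noteq> v"
    using uv(1) in_arcsD1 in_arcsD2 no_loops' by blast+
  then show ?thesis
    using uv pair_graph_contract_edge[OF pair_graph uv(1)] pair_finite_verts
      card_Diff1_less[of "pverts G" v]
    by (auto simp: simple_graph_def contract_edge_def)
qed

lemma proper_minor_smaller:
  assumes "simple_graph G" "is_minor H G" "H \<noteq> G"
  shows "simple_graph H"
    and "card (pverts H) < card (pverts G) \<or>
         pverts H = pverts G \<and> card (parcs H) < card (parcs G)"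
proof -
  interpret pair_graph G using assms(1) by (simp add: simple_graph_def)
  obtain K where K: "simple_graph K" "subgraph (with_proj K) (with_proj G)" "contracts_to\<^sup>*\<^sup>* K H"
    using assms(2) by (auto simp: is_minor_def)
  have KG: "pverts K \<subseteq> pverts G" "parcs K \<subseteq> parcs G"
    using K(2) by (auto simp: subgraph_def)
  have H: "simple_graph H \<and> (H = K \<or> card (pverts H) < card (pverts K))"
    using K(3,1)
  proof (induction rule: rtranclp_induct)
    case (step H H')
    then show ?case using contracts_to_smaller[of H H'] by auto
  qed simp
  then show "simple_graph H" by simp
  have "card (pverts K) \<le> card (pverts G)"
    using KG pair_finite_verts card_mono by blast
  moreover have "card (pverts K) < card (pverts G) \<or>
      pverts K = pverts G \<and> card (parcs K) < card (parcs G)" if "K \<noteq> G"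
  proof (cases "pverts K = pverts G")
    case True
    then have "parcs K \<noteq> parcs G" using that by (cases K, cases G) simp
    then show ?thesis using True KG pair_finite_arcs by (simp add: psubset_card_mono psubsetI)
  next
    case False
    then show ?thesis using KG pair_finite_verts by (simp add: psubset_card_mono psubsetI)
  qed
  ultimately show "card (pverts H) < card (pverts G) \<or>
      pverts H = pverts G \<and> card (parcs H) < card (parcs G)"
    using H assms(3) by auto
qed

lemma connectivity_greatest:
  assumes "simple_graph G"
  shows "connectivity G < card (pverts G)" "l < connectivity G \<Longrightarrow> \<not> has_cut G l"
    and "k < card (pverts G) \<Longrightarrow> \<forall>l<k. \<not> has_cut G l \<Longrightarrow> k \<le> connectivity G"
proof -
  interpret pair_graph G using assms by (simp add: simple_graph_def)
  let ?A = "{k. k < card (pverts G) \<and> (\<forall>l<k. \<not> has_cut G l)}"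
  have "0 \<in> ?A"
    using assms pair_finite_verts by (simp add: simple_graph_def card_gt_0_iff)
  moreover have fin: "finite ?A" by simp
  ultimately have "connectivity G \<in> ?A"
    unfolding connectivity_def by (intro Max_in) auto
  then show "connectivity G < card (pverts G)" "l < connectivity G \<Longrightarrow> \<not> has_cut G l"
    by auto
  show "k < card (pverts G) \<Longrightarrow> \<forall>l<k. \<not> has_cut G l \<Longrightarrow> k \<le> connectivity G"
    unfolding connectivity_def using fin by (intro Max_ge) auto
qed

end

theory Submission
  imports Defs
begin

text \<open>
  Suppose \<open>\<kappa>(G) \<ge> 6\<close>, so that all degrees are at least 6, and let \<open>n\<close> be the number of vertices. For an
  edge \<open>e\<close> the graph \<open>G - e\<close> is apex, so \<open>G - e - v\<close> is planar for some \<open>v\<close>; for an edge \<open>f\<close> at \<open>v\<close>,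
  \<open>G - f - w\<close> is planar for some \<open>w\<close>, and \<open>w \<noteq> v\<close> since \<open>G - f - v = G - v\<close> is nonplanar. A planar graph
  on \<open>n - 1\<close> vertices has at most \<open>3(n - 1) - 5\<close> edges (one more than Euler's bound suffices), so
  \<open>2|E| \<le> 2(3n - 8) + 2 + deg v + deg w\<close>. But the degrees sum to at least \<open>6(n - 2) + deg v + deg w\<close>.

  The bound \<open>3n - 5\<close> holds for all graphs without a \<open>K33\<close> minor, which avoids Euler's formula: the
  only topological input is that \<open>K33\<close> is not planar, in a version stable under contraction.
\<close>

text \<open>Two exceptional vertices are needed because the bound from a single one, compared with
  the degree sum, leaves deg v uncontrolled. In the sum of two bounds deg v and deg w cancel, and 6n
  - 14 is left against 6(n - 2). With m = n - 1, the bound 3m - 5 is the weakest of the form 3m - c,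
  c an integer, that still gives a contradiction. It is also the best that excluding
  \<open>K33\<close> alone can give: K5 has 10 = 3 * 5 - 5 edges and, with five vertices, no
  \<open>K33\<close> minor. Hence a K5 subgraph cannot be refuted outright in the induction; the
  rest of the graph around it has to be examined.

  The induction contracts edges, and a contraction destroys a drawing by points and arcs, so
  vertices are drawn as sets. Removing one vertex n from \<open>K33\<close> leaves a theta curve:
  three arcs between the other two vertices p and q of its side, each through one vertex of the
  opposite side. Since n reaches all three arcs without crossing any, the theta curve would have a
  face with all three on its boundary.\<close>

hide_const (open) Digraph_Component.connected

subsection \<open>Theta curves\<close>

lemma Jordan_theta_cycle:
  fixes c d :: "real \<Rightarrow> complex"
  assumes "arc c" "arc d" "pathstart c = p" "pathfinish c = q" "pathstart d = p" "pathfinish d = q"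
    and "path_image c \<inter> path_image d = {p, q}"
  defines "C \<equiv> path_image c \<union> path_image d"
  shows "inside C \<noteq> {}" "connected (inside C)" "connected (outside C)"
    and "inside C \<union> outside C = - C" "frontier (inside C) = C" "closed C"
proof -
  let ?g = "c +++ reversepath d"
  have sp: "simple_path ?g"
    using assms by (simp add: simple_path_join_loop_eq arc_reversepath)
  have im: "path_image ?g = C"
    using assms by (simp add: path_image_join)
  have "pathfinish ?g = pathstart ?g"
    using assms by simp
  from Jordan_inside_outside[OF sp this] show "inside C \<noteq> {}" "connected (inside C)"
    "connected (outside C)" "inside C \<union> outside C = - C" "frontier (inside C) = C"
    unfolding im by auto
  show "closed C"
    using closed_simple_path_image[OF sp] unfolding im .
qed

lemma connected_subset_inside:
  fixes C :: "'a::real_normed_vector set"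
  assumes "connected T" "T \<inter> C = {}" "T \<inter> inside C \<noteq> {}"
  shows "T \<subseteq> inside C"
proof
  fix y assume "y \<in> T"
  moreover obtain x where "x \<in> T" "x \<in> inside C"
    using assms(3) by blast
  moreover have "T \<subseteq> - C"
    using assms(2) by blast
  ultimately show "y \<in> inside C"
    using assms(1) inside_same_component connected_component_def by metis
qed

text \<open>An arc \<open>c3\<close> inside the cycle of \<open>c1\<close> and \<open>c2\<close>
  would cut its inside into two halves and trap \<open>U3\<close>, hence \<open>n\<close>, in it.
  The half containing \<open>n\<close> is bounded by \<open>c3\<close> and one of \<open>c1\<close>,
  \<open>c2\<close>; the star from \<open>n\<close> to the other arc avoids that boundary, so this
  other arc would have points inside a cycle that it belongs to.\<close>

lemma theta_bridge_inside:
  fixes c1 c2 c3 :: "real \<Rightarrow> complex"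
  assumes arcs: "arc c1" "arc c2" "arc c3"
    and ends: "pathstart c1 = p" "pathfinish c1 = q" "pathstart c2 = p" "pathfinish c2 = q"
      "pathstart c3 = p" "pathfinish c3 = q"
    and int: "path_image c1 \<inter> path_image c2 = {p, q}" "path_image c1 \<inter> path_image c3 = {p, q}"
      "path_image c2 \<inter> path_image c3 = {p, q}"
    and U1: "connected U1" "n \<in> U1" "path_image c1 - {p, q} \<subseteq> U1"
      "U1 \<inter> (path_image c2 \<union> path_image c3) = {}"
    and U2: "connected U2" "n \<in> U2" "path_image c2 - {p, q} \<subseteq> U2"
      "U2 \<inter> (path_image c1 \<union> path_image c3) = {}"
    and U3: "connected U3" "n \<in> U3" "path_image c3 - {p, q} \<subseteq> U3"
      "U3 \<inter> (path_image c1 \<union> path_image c2) = {}"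
  shows "path_image c3 \<inter> inside (path_image c1 \<union> path_image c2) = {}"
proof (rule ccontr)
  assume meets: "\<not> ?thesis"
  have "p \<noteq> q"
    using arcs(1) ends(1,2) arc_distinct_ends by blast
  have I: "inside (path_image c1 \<union> path_image c3) \<union> inside (path_image c2 \<union> path_image c3) \<union>
      (path_image c3 - {p, q}) = inside (path_image c1 \<union> path_image c2)"
    by (rule split_inside_simple_closed_curve[of c1 p q c2 c3])
       (use arcs ends int meets \<open>p \<noteq> q\<close> arc_imp_simple_path in auto)
  have ne: "path_image c1 - {p, q} \<noteq> {}" "path_image c2 - {p, q} \<noteq> {}"
    using nonempty_simple_path_endless[OF arc_imp_simple_path[OF arcs(1)]]
      nonempty_simple_path_endless[OF arc_imp_simple_path[OF arcs(2)]] ends by auto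
  have no: "path_image c1 \<inter> inside (path_image c1 \<union> path_image c2) = {}"
    "path_image c2 \<inter> inside (path_image c1 \<union> path_image c2) = {}"
    using inside_no_overlap by blast+
  have "p \<in> path_image c1" "q \<in> path_image c1"
    using ends(1,2) pathstart_in_path_image pathfinish_in_path_image by metis+
  then have "p \<notin> inside (path_image c1 \<union> path_image c2)" "q \<notin> inside (path_image c1 \<union> path_image c2)"
    using no(1) by blast+
  then have "path_image c3 \<inter> inside (path_image c1 \<union> path_image c2) \<subseteq> U3"
    using U3(3) by blast
  then have "U3 \<subseteq> inside (path_image c1 \<union> path_image c2)"
    using connected_subset_inside[OF U3(1,4)] meets by blast
  \<comment> \<open>\<open>U2\<close> contains \<open>n\<close> and avoids \<open>c3\<close>, so
    \<open>n\<close> is not on the arc between the two halves.\<close>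
  then have "n \<in> inside (path_image c1 \<union> path_image c3) \<or> n \<in> inside (path_image c2 \<union> path_image c3)"
    using I U3(2) U2(2,4) by blast
  then have "U2 \<subseteq> inside (path_image c1 \<union> path_image c3) \<or> U1 \<subseteq> inside (path_image c2 \<union> path_image c3)"
    using connected_subset_inside[OF U2(1,4)] connected_subset_inside[OF U1(1,4)] U1(2) U2(2) by blast
  moreover obtain y z where "y \<in> path_image c1" "y \<in> U1" "z \<in> path_image c2" "z \<in> U2"
    using ne U1(3) U2(3) by blast
  ultimately have "z \<in> path_image c2 \<inter> inside (path_image c1 \<union> path_image c2) \<or>
      y \<in> path_image c1 \<inter> inside (path_image c1 \<union> path_image c2)"
    unfolding I[symmetric] by blast
  then show False
    unfolding no by blast
qed

text \<open>If no bridge lies inside the cycle formed by the other two, then a point inside one of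
  the cycles is outside the other two; by Janiszewski's theorem it is not separated from \<open>n\<close> by
  the union of these two, although the first cycle separates it from \<open>n\<close>.\<close>

lemma theta_no_common_face:
  fixes c1 c2 c3 :: "real \<Rightarrow> complex"
  assumes arcs: "arc c1" "arc c2" "arc c3"
    and ends: "pathstart c1 = p" "pathfinish c1 = q" "pathstart c2 = p" "pathfinish c2 = q"
      "pathstart c3 = p" "pathfinish c3 = q"
    and int: "path_image c1 \<inter> path_image c2 = {p, q}" "path_image c1 \<inter> path_image c3 = {p, q}"
      "path_image c2 \<inter> path_image c3 = {p, q}"
    and U1: "connected U1" "n \<in> U1" "path_image c1 - {p, q} \<subseteq> U1"
      "U1 \<inter> (path_image c2 \<union> path_image c3) = {}"
    and U2: "connected U2" "n \<in> U2" "path_image c2 - {p, q} \<subseteq> U2"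
      "U2 \<inter> (path_image c1 \<union> path_image c3) = {}"
    and U3: "connected U3" "n \<in> U3" "path_image c3 - {p, q} \<subseteq> U3"
      "U3 \<inter> (path_image c1 \<union> path_image c2) = {}"
  shows False
proof -
  let ?I12 = "inside (path_image c1 \<union> path_image c2)"
  let ?I13 = "inside (path_image c1 \<union> path_image c3)"
  let ?I23 = "inside (path_image c2 \<union> path_image c3)"
  have ne: "path_image c1 - {p, q} \<noteq> {}" "path_image c2 - {p, q} \<noteq> {}" "path_image c3 - {p, q} \<noteq> {}"
    using nonempty_simple_path_endless[OF arc_imp_simple_path[OF arcs(1)]]
      nonempty_simple_path_endless[OF arc_imp_simple_path[OF arcs(2)]]
      nonempty_simple_path_endless[OF arc_imp_simple_path[OF arcs(3)]] ends by auto
  have o3: "path_image c3 \<inter> ?I12 = {}"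
    by (rule theta_bridge_inside[OF arcs ends int U1 U2 U3])
  have o2: "path_image c2 \<inter> ?I13 = {}"
    using theta_bridge_inside[of c1 c3 c2 p q U1 n U3 U2] arcs ends int U1 U2 U3
    by (simp add: Un_commute Int_commute)
  have o1: "path_image c1 \<inter> ?I23 = {}"
    using theta_bridge_inside[of c2 c3 c1 p q U2 n U3 U1] arcs ends int U1 U2 U3
    by (simp add: Un_commute Int_commute)
  note J12 = Jordan_theta_cycle[OF arcs(1,2) ends(1-4) int(1)]
  note J13 = Jordan_theta_cycle[OF arcs(1,3) ends(1,2,5,6) int(2)]
  note J23 = Jordan_theta_cycle[OF arcs(2,3) ends(3-6) int(3)]
  have n12: "n \<notin> ?I12"
    using connected_subset_inside[OF U3(1,4)] U3(2,3) o3 ne(3) by blast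
  have n13: "n \<notin> ?I13"
    using connected_subset_inside[OF U2(1,4)] U2(2,3) o2 ne(2) by blast
  have n23: "n \<notin> ?I23"
    using connected_subset_inside[OF U1(1,4)] U1(2,3) o1 ne(1) by blast
  obtain x where x: "x \<in> ?I12"
    using J12(1) by blast
  have xC: "x \<notin> path_image c1" "x \<notin> path_image c2" "x \<notin> path_image c3"
    using x o3 inside_no_overlap by blast+
  have x13: "x \<notin> ?I13"
  proof
    assume "x \<in> ?I13"
    then have "?I12 \<subseteq> ?I13"
      using connected_subset_inside[OF J12(2), of "path_image c1 \<union> path_image c3"] x o3
        inside_no_overlap by blast
    \<comment> \<open>Passing to closures brings in the frontier: the interior of \<open>c2\<close>
      would have to enter \<open>?I13\<close>, against \<open>o2\<close>.\<close>
    then have "closure ?I12 \<subseteq> closure ?I13"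
      by (rule closure_mono)
    then have "path_image c2 \<subseteq> ?I13 \<union> (path_image c1 \<union> path_image c3)"
      using J12(5) J13(5) closure_Un_frontier by blast
    then show False
      using o2 ne(2) int(1,3) by blast
  qed
  have x23: "x \<notin> ?I23"
  proof
    assume "x \<in> ?I23"
    then have "?I12 \<subseteq> ?I23"
      using connected_subset_inside[OF J12(2), of "path_image c2 \<union> path_image c3"] x o3
        inside_no_overlap by blast
    then have "closure ?I12 \<subseteq> closure ?I23"
      by (rule closure_mono)
    then have "path_image c1 \<subseteq> ?I23 \<union> (path_image c2 \<union> path_image c3)"
      using J12(5) J23(5) closure_Un_frontier by blast
    then show False
      using o1 ne(1) int(1,2) by blast
  qed
  have "x \<in> outside (path_image c1 \<union> path_image c3)" "n \<in> outside (path_image c1 \<union> path_image c3)"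
    using J13(4) x13 n13 xC U2(2,4) by blast+
  moreover have "outside (path_image c1 \<union> path_image c3) \<subseteq> - (path_image c1 \<union> path_image c3)"
    using J13(4) by blast
  ultimately have cc13: "connected_component (- (path_image c1 \<union> path_image c3)) x n"
    using J13(3) connected_component_def by metis
  have "x \<in> outside (path_image c2 \<union> path_image c3)" "n \<in> outside (path_image c2 \<union> path_image c3)"
    using J23(4) x23 n23 xC U1(2,4) by blast+
  moreover have "outside (path_image c2 \<union> path_image c3) \<subseteq> - (path_image c2 \<union> path_image c3)"
    using J23(4) by blast
  ultimately have cc23: "connected_component (- (path_image c2 \<union> path_image c3)) x n"
    using J23(3) connected_component_def by metis
  \<comment> \<open>Janiszewski's theorem asks for a connected intersection of the two sets; the
    cycles through \<open>c3\<close> share exactly the arc \<open>c3\<close>.\<close>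
  have "(path_image c1 \<union> path_image c3) \<inter> (path_image c2 \<union> path_image c3) = path_image c3"
    using int by blast
  then have "connected ((path_image c1 \<union> path_image c3) \<inter> (path_image c2 \<union> path_image c3))"
    using connected_arc_image[OF arcs(3)] by simp
  moreover have "compact (path_image c1 \<union> path_image c3)"
    using arcs compact_Un compact_arc_image by blast
  ultimately have "connected_component
      (- ((path_image c1 \<union> path_image c3) \<union> (path_image c2 \<union> path_image c3))) x n"
    using Janiszewski cc13 cc23 J23(6) by blast
  then have "connected_component (- (path_image c1 \<union> path_image c2)) x n"
    by (rule connected_component_of_subset) blast
  then show False
    using inside_same_component x n12 by blast
qed

subsection \<open>Thick drawings of \<open>K33\<close>\<close>

text \<open>The path is cut where it first meets \<open>C\<close>; if it starts in \<open>C\<close>,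
  the constant path serves. This makes a link touch a vertex set in a single point.\<close>

lemma path_to_first_hit:
  fixes g :: "real \<Rightarrow> 'a::real_normed_vector"
  assumes "path g" "closed C" "pathfinish g \<in> C"
  obtains h where "path h" "pathstart h = pathstart g" "path_image h \<subseteq> path_image g"
    "path_image h \<inter> C = {pathfinish h}"
proof (cases "pathstart g \<in> C")
  case True
  have "path_image (linepath (pathstart g) (pathstart g)) = {pathstart g}"
    by simp
  then show ?thesis
    using True pathstart_in_path_image[of g]
    by (intro that[of "linepath (pathstart g) (pathstart g)"]) simp_all
next
  case False
  have "pathstart g \<in> closure (- C)"
    using False closure_subset by blast
  then obtain h where h: "path h" "pathstart h = pathstart g" "path_image h \<subseteq> path_image g"
      "path_image h - {pathfinish h} \<subseteq> interior (- C)" "pathfinish h \<in> frontier (- C)"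
    using exists_path_subpath_to_frontier[of g "- C"] assms by auto
  have "frontier (- C) \<subseteq> C"
    using assms(2) by (simp add: frontier_complement frontier_subset_closed)
  then have "path_image h \<inter> C = {pathfinish h}"
    using h(4,5) interior_subset[of "- C"] pathfinish_in_path_image[of h] by blast
  then show ?thesis
    using that h by blast
qed

text \<open>Join \<open>y i\<close> to \<open>y j\<close> by an arc and walk from \<open>y k\<close>
  until the arc is hit; the hit point is the centre \<open>p\<close>. An arc is taken because its
  injectivity makes the two halves meet only in \<open>p\<close>. The legs themselves may be
  constant or self-crossing.\<close>

lemma path_connected_tripod:
  fixes P :: "'a::{complete_space,real_normed_vector} set" and y :: "'i \<Rightarrow> 'a"
  assumes P: "path_connected P" and y: "y i \<in> P" "y j \<in> P" "y k \<in> P"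
    and dist: "i \<noteq> j" "i \<noteq> k" "j \<noteq> k"
  obtains p t where "p \<in> P"
    "\<forall>a\<in>{i, j, k}. path (t a) \<and> pathstart (t a) = p \<and> pathfinish (t a) = y a \<and> path_image (t a) \<subseteq> P"
    "\<forall>a\<in>{i, j, k}. \<forall>b\<in>{i, j, k}. a \<noteq> b \<longrightarrow> path_image (t a) \<inter> path_image (t b) = {p}"
proof (cases "y i = y j")
  case True
  obtain g where g: "path g" "path_image g \<subseteq> P" "pathstart g = y i" "pathfinish g = y k"
    using P y unfolding path_connected_def by meson
  have "y i \<in> path_image g"
    using g(3) pathstart_in_path_image by metis
  then show ?thesis
    by (intro that[of "y i" "\<lambda>a. if a = k then g else linepath (y i) (y i)"])
       (use True g y dist in \<open>auto split: if_splits\<close>)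
next
  case False
  then obtain \<gamma> where \<gamma>: "arc \<gamma>" "path_image \<gamma> \<subseteq> P" "pathstart \<gamma> = y i" "pathfinish \<gamma> = y j"
    using P y unfolding path_connected_arcwise by meson
  obtain f where f: "path f" "path_image f \<subseteq> P" "pathstart f = y k" "pathfinish f = y i"
    using P y unfolding path_connected_def by meson
  have "pathfinish f \<in> path_image \<gamma>"
    using f(4) \<gamma>(3) pathstart_in_path_image by metis
  then obtain h where h: "path h" "pathstart h = y k" "path_image h \<subseteq> path_image f"
      "path_image h \<inter> path_image \<gamma> = {pathfinish h}"
    using path_to_first_hit[OF f(1) closed_arc_image[OF \<gamma>(1)]] f(3) by metis
  then have "pathfinish h \<in> path_image \<gamma>"
    by blast
  then obtain s where s: "0 \<le> s" "s \<le> 1" "pathfinish h = \<gamma> s"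
    unfolding path_image_def by auto
  define p where "p = pathfinish h"
  define t where "t a = (if a = i then reversepath (subpath 0 s \<gamma>) else if a = j then subpath s 1 \<gamma>
    else reversepath h)" for a
  have sub: "path_image (subpath 0 s \<gamma>) \<subseteq> path_image \<gamma>" "path_image (subpath s 1 \<gamma>) \<subseteq> path_image \<gamma>"
    using s by (simp_all add: path_image_subpath_subset)
  have "path_image (subpath 0 s \<gamma>) \<inter> path_image (subpath s 1 \<gamma>) = \<gamma> ` {0..s} \<inter> \<gamma> ` {s..1}"
    using s by (simp add: path_image_subpath)
  also have "\<dots> = \<gamma> ` ({0..s} \<inter> {s..1})"
    using \<gamma>(1) s by (intro inj_on_image_Int[symmetric, of \<gamma> "{0..1}"]) (auto simp: arc_def)
  also have "{0..s} \<inter> {s..1} = {s}"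
    using s by auto
  finally have ij: "path_image (subpath 0 s \<gamma>) \<inter> path_image (subpath s 1 \<gamma>) = {p}"
    using s(3) by (simp add: p_def)
  have ph: "p \<in> path_image h"
    using pathfinish_in_path_image[of h] by (simp only: p_def)
  have inter: "path_image (subpath 0 s \<gamma>) \<inter> path_image h = {p}"
      "path_image (subpath s 1 \<gamma>) \<inter> path_image h = {p}"
    using ij sub h(4) ph unfolding p_def[symmetric] by blast+
  have ends: "\<gamma> 0 = y i" "\<gamma> 1 = y j"
    using \<gamma>(3,4) by (simp_all add: pathstart_def pathfinish_def)
  have paths: "path (subpath 0 s \<gamma>)" "path (subpath s 1 \<gamma>)"
    using \<gamma>(1) s by (simp_all add: arc_imp_path path_subpath)
  show ?thesis
  proof (rule that[of p t])
    show "p \<in> P"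
      using ph h(3) f(2) by blast
    show "\<forall>a\<in>{i, j, k}. path (t a) \<and> pathstart (t a) = p \<and> pathfinish (t a) = y a \<and> path_image (t a) \<subseteq> P"
      using dist paths h(1,2,3) f(2) sub \<gamma>(2) s(3) ends by (auto simp: t_def p_def)
    show "\<forall>a\<in>{i, j, k}. \<forall>b\<in>{i, j, k}. a \<noteq> b \<longrightarrow> path_image (t a) \<inter> path_image (t b) = {p}"
      using dist ij inter by (simp add: t_def Int_commute)
  qed
qed

text \<open>This turns a vertex drawn as a set \<open>P\<close> back into a point \<open>p\<close>
  with three genuine arcs leaving it. Each link is cut at its first point \<open>y a\<close> of
  \<open>P\<close>, and the three feet \<open>y a\<close> are joined by a tripod within
  \<open>P\<close>. Tripod path and link together need not be injective, so an arc is chosen in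
  their union.\<close>

lemma tripod_with_legs:
  fixes P :: "'a::{complete_space,real_normed_vector} set" and S :: "'i \<Rightarrow> 'a set"
  assumes P: "path_connected P" "closed P" and dist: "i \<noteq> j" "i \<noteq> k" "j \<noteq> k"
    and S: "\<And>a. a \<in> {i, j, k} \<Longrightarrow> path_connected (S a) \<and> S a \<inter> P \<noteq> {} \<and> m a \<in> S a - P"
    and SS: "\<And>a b. a \<in> {i, j, k} \<Longrightarrow> b \<in> {i, j, k} \<Longrightarrow> a \<noteq> b \<Longrightarrow> S a \<inter> S b \<subseteq> P"
  obtains p g where "p \<in> P"
    "\<forall>a\<in>{i, j, k}. arc (g a) \<and> pathstart (g a) = p \<and> pathfinish (g a) = m a \<and> path_image (g a) \<subseteq> P \<union> S a"
    "\<forall>a\<in>{i, j, k}. \<forall>b\<in>{i, j, k}. a \<noteq> b \<longrightarrow> path_image (g a) \<inter> path_image (g b) = {p}"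
proof -
  have "\<exists>h. path h \<and> pathstart h = m a \<and> path_image h \<subseteq> S a \<and> path_image h \<inter> P = {pathfinish h}"
    if a: "a \<in> {i, j, k}" for a
  proof -
    obtain x where x: "x \<in> S a" "x \<in> P"
      using S[OF a] by blast
    have "path_connected (S a)" "m a \<in> S a"
      using S[OF a] by blast+
    then obtain f where "path f" "path_image f \<subseteq> S a" "pathstart f = m a" "pathfinish f = x"
      using x(1) unfolding path_connected_def by meson
    then show ?thesis
      using path_to_first_hit[OF _ P(2), of f] x(2) by (metis order_trans)
  qed
  then obtain h where h: "\<And>a. a \<in> {i, j, k} \<Longrightarrow> path (h a) \<and> pathstart (h a) = m a \<and>
      path_image (h a) \<subseteq> S a \<and> path_image (h a) \<inter> P = {pathfinish (h a)}"
    by metis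
  define y where "y a = pathfinish (h a)" for a
  have hP: "path_image (h a) \<inter> P = {y a}" if "a \<in> {i, j, k}" for a
    using h[OF that] by (simp add: y_def)
  have "y i \<in> P" "y j \<in> P" "y k \<in> P"
    using hP[of i] hP[of j] hP[of k] by blast+
  then obtain p t where p: "p \<in> P"
    and t: "\<forall>a\<in>{i, j, k}. path (t a) \<and> pathstart (t a) = p \<and> pathfinish (t a) = y a \<and> path_image (t a) \<subseteq> P"
    and tt: "\<forall>a\<in>{i, j, k}. \<forall>b\<in>{i, j, k}. a \<noteq> b \<longrightarrow> path_image (t a) \<inter> path_image (t b) = {p}"
    using path_connected_tripod[OF P(1) _ _ _ dist] by blast
  have "\<exists>g. arc g \<and> path_image g \<subseteq> path_image (t a) \<union> path_image (h a) \<and> pathstart g = p \<and> pathfinish g = m a"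
    if a: "a \<in> {i, j, k}" for a
  proof -
    let ?f = "t a +++ reversepath (h a)"
    have "path ?f" "pathstart ?f = p" "pathfinish ?f = m a"
      "path_image ?f = path_image (t a) \<union> path_image (h a)"
      using bspec[OF t a] h[OF a] by (simp_all add: y_def path_image_join)
    moreover have "p \<noteq> m a"
      using p S[OF a] by blast
    ultimately show ?thesis
      using path_contains_arc by metis
  qed
  then obtain g where g: "\<And>a. a \<in> {i, j, k} \<Longrightarrow> arc (g a) \<and>
      path_image (g a) \<subseteq> path_image (t a) \<union> path_image (h a) \<and> pathstart (g a) = p \<and> pathfinish (g a) = m a"
    by metis
  have gg: "path_image (g a) \<inter> path_image (g b) = {p}"
    if a: "a \<in> {i, j, k}" and b: "b \<in> {i, j, k}" and "a \<noteq> b" for a b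
  proof -
    have yt: "y a \<in> path_image (t a)" "y b \<in> path_image (t b)"
      using bspec[OF t a] bspec[OF t b] pathfinish_in_path_image by metis+
    have tP: "path_image (t a) \<subseteq> P" "path_image (t b) \<subseteq> P"
      using bspec[OF t a] bspec[OF t b] by blast+
    have hS: "path_image (h a) \<inter> path_image (h b) \<subseteq> P"
      using h[OF a] h[OF b] SS[OF a b \<open>a \<noteq> b\<close>] by blast
    have ab: "path_image (t a) \<inter> path_image (t b) = {p}"
      using mp[OF bspec[OF bspec[OF tt a] b] \<open>a \<noteq> b\<close>] .
    have hyt: "path_image (h a) \<inter> P \<subseteq> path_image (t a)" "path_image (h b) \<inter> P \<subseteq> path_image (t b)"
      using yt unfolding hP[OF a] hP[OF b] by blast+
    \<comment> \<open>A common point lies in \<open>P\<close>, where a link has only its foot, and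
      the foot is on the tripod path of the same index.\<close>
    have "(path_image (t a) \<union> path_image (h a)) \<inter> (path_image (t b) \<union> path_image (h b))
        \<subseteq> path_image (t a) \<inter> path_image (t b)"
      using tP hS hyt by blast
    then have "path_image (g a) \<inter> path_image (g b) \<subseteq> {p}"
      using g[OF a] g[OF b] unfolding ab by blast
    moreover have "p \<in> path_image (g a)" "p \<in> path_image (g b)"
      using g[OF a] g[OF b] pathstart_in_path_image by metis+
    ultimately show ?thesis
      by blast
  qed
  show ?thesis
  proof (rule that[OF p]; intro ballI impI)
    fix a assume a: "a \<in> {i, j, k}"
    show "arc (g a) \<and> pathstart (g a) = p \<and> pathfinish (g a) = m a \<and> path_image (g a) \<subseteq> P \<union> S a"
      using g[OF a] bspec[OF t a] h[OF a] by blast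
  qed (rule gg)
qed

text \<open>The sides of the \<open>K33\<close> are \<open>M i, M j, M k\<close> and \<open>P, Q, {n}\<close>; \<open>S a\<close> and \<open>T a\<close> link \<open>M a\<close> to \<open>P\<close> and
  \<open>Q\<close>, and \<open>N a\<close> links it to \<open>n\<close>. The \<open>N a\<close> may overlap arbitrarily, so the third vertex can be any
  connected set.\<close>

lemma no_thick_K33:
  fixes M S T N :: "'i \<Rightarrow> complex set"
  assumes dist: "i \<noteq> j" "i \<noteq> k" "j \<noteq> k"
    and P: "path_connected P" "closed P" and Q: "path_connected Q" "closed Q" and PQ: "P \<inter> Q = {}"
    and M: "\<And>a. a \<in> {i, j, k} \<Longrightarrow> path_connected (M a) \<and> M a \<inter> P = {} \<and> M a \<inter> Q = {}"
    and S: "\<And>a. a \<in> {i, j, k} \<Longrightarrow> path_connected (S a) \<and> S a \<inter> P \<noteq> {} \<and> S a \<inter> M a \<noteq> {} \<and> S a \<inter> Q = {}"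
    and T: "\<And>a. a \<in> {i, j, k} \<Longrightarrow> path_connected (T a) \<and> T a \<inter> Q \<noteq> {} \<and> T a \<inter> M a \<noteq> {} \<and> T a \<inter> P = {}"
    and ST: "\<And>a. a \<in> {i, j, k} \<Longrightarrow> S a \<inter> T a \<subseteq> M a"
    and N: "\<And>a. a \<in> {i, j, k} \<Longrightarrow> connected (N a) \<and> n \<in> N a \<and> N a \<inter> M a \<noteq> {} \<and> N a \<inter> P = {} \<and> N a \<inter> Q = {}"
    and disj: "\<And>a b. a \<in> {i, j, k} \<Longrightarrow> b \<in> {i, j, k} \<Longrightarrow> a \<noteq> b \<Longrightarrow>
      M a \<inter> M b = {} \<and> S a \<inter> M b = {} \<and> T a \<inter> M b = {} \<and> S a \<inter> T b = {} \<and> S a \<inter> S b \<subseteq> P \<and> T a \<inter> T b \<subseteq> Q \<and>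
      N a \<inter> M b = {} \<and> N a \<inter> S b = {} \<and> N a \<inter> T b = {}"
  shows False
proof -
  have "\<exists>x. x \<in> S a \<inter> M a" "\<exists>x. x \<in> T a \<inter> M a" if "a \<in> {i, j, k}" for a
    using S[OF that] T[OF that] by blast+
  then obtain m m' where m: "\<And>a. a \<in> {i, j, k} \<Longrightarrow> m a \<in> S a \<inter> M a"
      and m': "\<And>a. a \<in> {i, j, k} \<Longrightarrow> m' a \<in> T a \<inter> M a"
    by metis
  have legS: "path_connected (S a) \<and> S a \<inter> P \<noteq> {} \<and> m a \<in> S a - P"
    and legT: "path_connected (T a) \<and> T a \<inter> Q \<noteq> {} \<and> m' a \<in> T a - Q" if a: "a \<in> {i, j, k}" for a
    using S[OF a] T[OF a] m[OF a] m'[OF a] M[OF a] by blast+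
  have SS: "S a \<inter> S b \<subseteq> P" and TT: "T a \<inter> T b \<subseteq> Q"
    if "a \<in> {i, j, k}" "b \<in> {i, j, k}" "a \<noteq> b" for a b
    using disj[OF that] by blast+
  obtain p g where p: "p \<in> P"
    and g: "\<forall>a\<in>{i, j, k}. arc (g a) \<and> pathstart (g a) = p \<and> pathfinish (g a) = m a \<and> path_image (g a) \<subseteq> P \<union> S a"
    and gg: "\<forall>a\<in>{i, j, k}. \<forall>b\<in>{i, j, k}. a \<noteq> b \<longrightarrow> path_image (g a) \<inter> path_image (g b) = {p}"
    by (rule tripod_with_legs[OF P dist legS SS]) (assumption | rule that)+
  obtain q h where q: "q \<in> Q"
    and h: "\<forall>a\<in>{i, j, k}. arc (h a) \<and> pathstart (h a) = q \<and> pathfinish (h a) = m' a \<and> path_image (h a) \<subseteq> Q \<union> T a"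
    and hh: "\<forall>a\<in>{i, j, k}. \<forall>b\<in>{i, j, k}. a \<noteq> b \<longrightarrow> path_image (h a) \<inter> path_image (h b) = {q}"
    by (rule tripod_with_legs[OF Q dist legT TT]) (assumption | rule that)+
  have "p \<noteq> q"
    using p q PQ by blast
  have "\<exists>c. arc c \<and> path_image c \<subseteq> path_image (g a) \<union> M a \<union> path_image (h a) \<and> pathstart c = p \<and> pathfinish c = q"
    if a: "a \<in> {i, j, k}" for a
  proof -
    have "path_connected (M a)" "m a \<in> M a" "m' a \<in> M a"
      using M[OF a] m[OF a] m'[OF a] by blast+
    then obtain r where r: "path r" "path_image r \<subseteq> M a" "pathstart r = m a" "pathfinish r = m' a"
      unfolding path_connected_def by meson
    \<comment> \<open>From \<open>p\<close> along the link into \<open>M a\<close>, across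
      \<open>M a\<close>, and along the other link to \<open>q\<close>.\<close>
    let ?f = "g a +++ r +++ reversepath (h a)"
    have "path ?f" "pathstart ?f = p" "pathfinish ?f = q"
      "path_image ?f = path_image (g a) \<union> path_image r \<union> path_image (h a)"
      using bspec[OF g a] bspec[OF h a] r by (simp_all add: path_image_join arc_imp_path Un_assoc)
    then obtain c where "arc c" "path_image c \<subseteq> path_image (g a) \<union> path_image r \<union> path_image (h a)"
        "pathstart c = p" "pathfinish c = q"
      using path_contains_arc \<open>p \<noteq> q\<close> by metis
    then show ?thesis
      using r(2) by blast
  qed
  then obtain c where c: "\<And>a. a \<in> {i, j, k} \<Longrightarrow> arc (c a) \<and>
      path_image (c a) \<subseteq> path_image (g a) \<union> M a \<union> path_image (h a) \<and> pathstart (c a) = p \<and> pathfinish (c a) = q"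
    by metis
  have pqc: "p \<in> path_image (c a)" "q \<in> path_image (c a)" if "a \<in> {i, j, k}" for a
    using c[OF that] pathstart_in_path_image pathfinish_in_path_image by metis+
  have sub: "path_image (g a) \<subseteq> P \<union> S a" "path_image (h a) \<subseteq> Q \<union> T a" if "a \<in> {i, j, k}" for a
    using bspec[OF g that] bspec[OF h that] by blast+
  have apart: "path_image (g a) \<inter> M b = {}" "path_image (h a) \<inter> M b = {}"
      "path_image (g a) \<inter> path_image (h b) = {}" "M a \<inter> M b = {}"
      "M a \<inter> (P \<union> S b \<union> M b \<union> Q \<union> T b) = {}" "N a \<inter> (P \<union> S b \<union> M b \<union> Q \<union> T b) = {}"
    if ab: "a \<in> {i, j, k}" "b \<in> {i, j, k}" "a \<noteq> b" for a b
  proof -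
    have d: "M b \<inter> P = {}" "M b \<inter> Q = {}" "S a \<inter> M b = {}" "T a \<inter> M b = {}" "S a \<inter> T b = {}"
      "S a \<inter> Q = {}" "T b \<inter> P = {}"
      using M[OF ab(2)] S[OF ab(1)] T[OF ab(2)] disj[OF ab] by - (elim conjE, assumption)+
    have e: "M a \<inter> P = {}" "M a \<inter> Q = {}" "S b \<inter> M a = {}" "T b \<inter> M a = {}" "N a \<inter> P = {}" "N a \<inter> Q = {}"
      "N a \<inter> S b = {}" "N a \<inter> T b = {}" "N a \<inter> M b = {}"
      using M[OF ab(1)] N[OF ab(1)] disj[OF ab] disj[OF ab(2,1) ab(3)[symmetric]]
      by - (elim conjE, assumption)+
    show "M a \<inter> M b = {}"
      using disj[OF ab] by - (elim conjE, assumption)+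
    show "path_image (g a) \<inter> M b = {}"
      using sub(1)[OF ab(1)] d(1,3) by blast
    show "path_image (h a) \<inter> M b = {}"
      using sub(2)[OF ab(1)] d(2,4) by blast
    show "path_image (g a) \<inter> path_image (h b) = {}"
      using sub(1)[OF ab(1)] sub(2)[OF ab(2)] PQ d(5,6,7) by blast
    show "M a \<inter> (P \<union> S b \<union> M b \<union> Q \<union> T b) = {}"
      unfolding Int_Un_distrib e \<open>M a \<inter> M b = {}\<close> using e(3,4) by (simp add: Int_commute)
    show "N a \<inter> (P \<union> S b \<union> M b \<union> Q \<union> T b) = {}"
      unfolding Int_Un_distrib e by simp
  qed
  have cc: "path_image (c a) \<inter> path_image (c b) = {p, q}"
    if ab: "a \<in> {i, j, k}" "b \<in> {i, j, k}" "a \<noteq> b" for a b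
  proof
    have 1: "path_image (g a) \<inter> path_image (g b) = {p}" "path_image (h a) \<inter> path_image (h b) = {q}"
      using mp[OF bspec[OF bspec[OF gg ab(1)] ab(2)] ab(3)] mp[OF bspec[OF bspec[OF hh ab(1)] ab(2)] ab(3)] .
    note 2 = apart[OF ab]
    note 3 = apart[OF ab(2,1) ab(3)[symmetric]]
    have "path_image (c a) \<inter> path_image (c b) \<subseteq>
        (path_image (g a) \<union> M a \<union> path_image (h a)) \<inter> (path_image (g b) \<union> M b \<union> path_image (h b))"
      using c[OF ab(1)] c[OF ab(2)] by (intro Int_mono) blast+
    also have "\<dots> = {p, q}"
      using 1 2(1-4) 3(1-3) by (simp add: Int_Un_distrib Int_Un_distrib2 Int_commute Un_commute insert_commute)
    finally show "path_image (c a) \<inter> path_image (c b) \<subseteq> {p, q}" .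
    show "{p, q} \<subseteq> path_image (c a) \<inter> path_image (c b)"
      using pqc[OF ab(1)] pqc[OF ab(2)] by simp
  qed
  \<comment> \<open>The arc \<open>c a\<close> was extracted from a longer path and might have
    skipped \<open>M a\<close>. By \<open>ST\<close> the parts \<open>g a\<close> and
    \<open>h a\<close> meet only within \<open>M a\<close>, so outside \<open>M a\<close> they would
    disconnect \<open>c a\<close>.\<close>
  have cM: "path_image (c a) \<inter> M a \<noteq> {}" if a: "a \<in> {i, j, k}" for a
  proof
    assume empty: "path_image (c a) \<inter> M a = {}"
    have "path_image (c a) \<subseteq> path_image (g a) \<union> M a \<union> path_image (h a)"
      using c[OF a] by blast
    then have "path_image (c a) \<subseteq> path_image (g a) \<union> path_image (h a)"
      using empty by blast
    moreover have "S a \<inter> Q = {}" "T a \<inter> P = {}"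
      using S[OF a] T[OF a] by - (elim conjE, assumption)+
    then have "path_image (g a) \<inter> path_image (h a) \<subseteq> M a"
      using sub[OF a] ST[OF a] PQ by blast
    then have "path_image (g a) \<inter> path_image (h a) \<inter> path_image (c a) = {}"
      using empty by blast
    moreover have "p \<in> path_image (g a)" "q \<in> path_image (h a)"
      using bspec[OF g a] bspec[OF h a] pathstart_in_path_image by metis+
    moreover have "closed (path_image (g a))" "closed (path_image (h a))"
      using bspec[OF g a] bspec[OF h a] closed_arc_image by blast+
    moreover have "connected (path_image (c a))"
      using c[OF a] connected_arc_image by blast
    ultimately show False
      using pqc[OF a] unfolding connected_closed by blast
  qed
  \<comment> \<open>The star required for the theta curve: \<open>N a\<close> leads from
    \<open>n\<close> to \<open>M a\<close>, which meets the open arc \<open>c a\<close>.\<close>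
  define U where "U a = N a \<union> M a \<union> (path_image (c a) - {p, q})" for a
  have U: "connected (U a)" "n \<in> U a" "path_image (c a) - {p, q} \<subseteq> U a" if a: "a \<in> {i, j, k}" for a
  proof -
    have "connected (path_image (c a) - {p, q})"
      using c[OF a] connected_simple_path_endless[OF arc_imp_simple_path] by metis
    moreover have "M a \<inter> P = {}" "M a \<inter> Q = {}"
      using M[OF a] by - (elim conjE, assumption)+
    then have "(N a \<union> M a) \<inter> (path_image (c a) - {p, q}) \<noteq> {}"
      using cM[OF a] p q by blast
    moreover have "connected (N a \<union> M a)"
      using N[OF a] M[OF a] by (simp add: connected_Un path_connected_imp_connected)
    ultimately show "connected (U a)"
      unfolding U_def by (intro connected_Un[of "N a \<union> M a"])
  qed (use N[OF a] in \<open>simp_all add: U_def\<close>)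
  have Uc: "U a \<inter> path_image (c b) = {}" if ab: "a \<in> {i, j, k}" "b \<in> {i, j, k}" "a \<noteq> b" for a b
  proof -
    have "path_image (c b) \<subseteq> path_image (g b) \<union> M b \<union> path_image (h b)"
      using c[OF ab(2)] by blast
    then have "path_image (c b) \<subseteq> P \<union> S b \<union> M b \<union> Q \<union> T b"
      using sub[OF ab(2)] by blast
    then have "(N a \<union> M a) \<inter> path_image (c b) = {}"
      using apart(5,6)[OF ab] by blast
    moreover have "(path_image (c a) - {p, q}) \<inter> path_image (c b) = {}"
      using cc[OF ab] by blast
    ultimately show ?thesis
      unfolding U_def by blast
  qed
  have I: "i \<in> {i, j, k}" "j \<in> {i, j, k}" "k \<in> {i, j, k}"
    by simp_all
  have U2: "U a \<inter> (path_image (c b) \<union> path_image (c d)) = {}"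
    if "a \<in> {i, j, k}" "b \<in> {i, j, k}" "d \<in> {i, j, k}" "a \<noteq> b" "a \<noteq> d" for a b d
    using Uc[OF that(1,2,4)] Uc[OF that(1,3,5)] by (simp add: Int_Un_distrib)
  note cI = c[OF I(1)] c[OF I(2)] c[OF I(3)]
  show False
    by (rule theta_no_common_face[of "c i" "c j" "c k" p q "U i" n "U j" "U k"])
       (use cI dist in \<open>simp_all only: cc I U U2 simp_thms not_sym\<close>)
qed

subsection \<open>Thick drawings and contraction\<close>

text \<open>Vertices are drawn as disjoint path-connected closed sets and edges as path-connected closed
  sets joining them, with no condition on how an edge meets the sets of its own ends. Unlike
  drawings by points and arcs, such drawings are trivially inherited by contractions.\<close>

definition thick_drawing ::
    "'a set \<Rightarrow> ('a \<times> 'a) set \<Rightarrow> ('a \<Rightarrow> complex set) \<Rightarrow> ('a set \<Rightarrow> complex set) \<Rightarrow> bool" where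
  "thick_drawing V R K A \<longleftrightarrow>
     (\<forall>v\<in>V. path_connected (K v) \<and> closed (K v) \<and> K v \<noteq> {}) \<and>
     (\<forall>u\<in>V. \<forall>v\<in>V. u \<noteq> v \<longrightarrow> K u \<inter> K v = {}) \<and>
     (\<forall>(u, v)\<in>R. path_connected (A {u, v}) \<and> closed (A {u, v}) \<and>
        A {u, v} \<inter> K u \<noteq> {} \<and> A {u, v} \<inter> K v \<noteq> {} \<and> (\<forall>w\<in>V - {u, v}. A {u, v} \<inter> K w = {})) \<and>
     (\<forall>(u, v)\<in>R. \<forall>(x, y)\<in>R. {u, v} \<noteq> {x, y} \<longrightarrow> A {u, v} \<inter> A {x, y} \<subseteq> \<Union> (K ` ({u, v} \<inter> {x, y})))"

definition thickly_planar :: "'a set \<Rightarrow> ('a \<times> 'a) set \<Rightarrow> bool" where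
  "thickly_planar V R \<longleftrightarrow>
     finite V \<and> R \<subseteq> V \<times> V \<and> sym R \<and> irrefl R \<and> (\<exists>K A. thick_drawing V R K A)"

lemma thick_drawingD:
  assumes "thick_drawing V R K A"
  shows "v \<in> V \<Longrightarrow> path_connected (K v)" "v \<in> V \<Longrightarrow> closed (K v)" "v \<in> V \<Longrightarrow> K v \<noteq> {}"
    and "u \<in> V \<Longrightarrow> v \<in> V \<Longrightarrow> u \<noteq> v \<Longrightarrow> K u \<inter> K v = {}"
    and "(u, v) \<in> R \<Longrightarrow> path_connected (A {u, v})" "(u, v) \<in> R \<Longrightarrow> closed (A {u, v})"
    and "(u, v) \<in> R \<Longrightarrow> A {u, v} \<inter> K u \<noteq> {}" "(u, v) \<in> R \<Longrightarrow> A {u, v} \<inter> K v \<noteq> {}"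
    and "(u, v) \<in> R \<Longrightarrow> w \<in> V \<Longrightarrow> w \<noteq> u \<Longrightarrow> w \<noteq> v \<Longrightarrow> A {u, v} \<inter> K w = {}"
    and "(u, v) \<in> R \<Longrightarrow> (x, y) \<in> R \<Longrightarrow> {u, v} \<noteq> {x, y} \<Longrightarrow>
      A {u, v} \<inter> A {x, y} \<subseteq> \<Union> (K ` ({u, v} \<inter> {x, y}))"
proof -
  have K: "\<forall>v\<in>V. path_connected (K v) \<and> closed (K v) \<and> K v \<noteq> {}"
    and KK: "\<forall>u\<in>V. \<forall>v\<in>V. u \<noteq> v \<longrightarrow> K u \<inter> K v = {}"
    and A: "\<forall>(u, v)\<in>R. path_connected (A {u, v}) \<and> closed (A {u, v}) \<and>
        A {u, v} \<inter> K u \<noteq> {} \<and> A {u, v} \<inter> K v \<noteq> {} \<and> (\<forall>w\<in>V - {u, v}. A {u, v} \<inter> K w = {})"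
    and AA: "\<forall>(u, v)\<in>R. \<forall>(x, y)\<in>R. {u, v} \<noteq> {x, y} \<longrightarrow>
        A {u, v} \<inter> A {x, y} \<subseteq> \<Union> (K ` ({u, v} \<inter> {x, y}))"
    using assms unfolding thick_drawing_def by - (elim conjE, assumption)+
  note A' = A[THEN bspec, of "(u, v)", unfolded prod.case]
  show "v \<in> V \<Longrightarrow> path_connected (K v)" "v \<in> V \<Longrightarrow> closed (K v)" "v \<in> V \<Longrightarrow> K v \<noteq> {}"
    using bspec[OF K, of v] by simp_all
  show "u \<in> V \<Longrightarrow> v \<in> V \<Longrightarrow> u \<noteq> v \<Longrightarrow> K u \<inter> K v = {}"
    using KK by simp
  show "path_connected (A {u, v})" "closed (A {u, v})" "A {u, v} \<inter> K u \<noteq> {}" "A {u, v} \<inter> K v \<noteq> {}"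
    if "(u, v) \<in> R"
    using A'[OF that] by - (elim conjE, assumption)+
  show "A {u, v} \<inter> K w = {}" if "(u, v) \<in> R" "w \<in> V" "w \<noteq> u" "w \<noteq> v"
    using A'[OF that(1)] that(2-4) by simp
  show "A {u, v} \<inter> A {x, y} \<subseteq> \<Union> (K ` ({u, v} \<inter> {x, y}))" if "(u, v) \<in> R" "(x, y) \<in> R" "{u, v} \<noteq> {x, y}"
    using bspec[OF bspec[OF AA that(1), unfolded prod.case] that(2), unfolded prod.case] that(3) by (rule mp)
qed

section \<open>\<open>K33\<close> subgraphs with one side vertex replaced by a connected set\<close>

text \<open>Each edge set meets the sets of both its ends, so connectedness travels along walks from
  \<open>d\<close>. The union can then stand for a single vertex of a \<open>K33\<close> in place of
  \<open>D\<close>, without contracting \<open>D\<close>.\<close>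

lemma connected_thick_union:
  assumes dr: "thick_drawing V R K A" and D: "D \<subseteq> V" "d \<in> D"
    and conn: "\<And>x. x \<in> D \<Longrightarrow> (d, x) \<in> (R \<inter> D \<times> D)\<^sup>*"
  shows "connected ((\<Union>x\<in>D. K x) \<union> (\<Union>(x, y)\<in>R \<inter> D \<times> D. A {x, y}))" (is "connected ?U")
proof -
  obtain p where p: "p \<in> K d"
    using thick_drawingD(3)[OF dr] D by blast
  let ?C = "connected_component_set ?U p"
  \<comment> \<open>The component of \<open>p\<close> swallows every connected part of the drawing
    that it touches; walks are then followed edge by edge.\<close>
  have absorb: "T \<subseteq> ?C" if "connected T" "T \<subseteq> ?U" "x \<in> T" "x \<in> ?C" for T x
    using connected_component_maximal[OF that(3,1,2)] connected_component_eq[OF that(4)] by simp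
  have conK: "connected (K x)" if "x \<in> D" for x
    using thick_drawingD(1)[OF dr] that D(1) path_connected_imp_connected by blast
  have edge: "K x \<union> A {x, y} \<union> K y \<subseteq> ?C" if "K x \<subseteq> ?C" "(x, y) \<in> R \<inter> D \<times> D" for x y
  proof -
    have R: "(x, y) \<in> R" and xy: "x \<in> D" "y \<in> D"
      using that(2) by auto
    have "connected (A {x, y})"
      using thick_drawingD(5)[OF dr R] path_connected_imp_connected by blast
    then have "connected (K x \<union> A {x, y} \<union> K y)"
      using conK[OF xy(1)] conK[OF xy(2)] thick_drawingD(7,8)[OF dr R]
      by (intro connected_Un) (simp_all add: Int_commute Int_Un_distrib)
    moreover have "K x \<union> A {x, y} \<union> K y \<subseteq> ?U"
      using that(2) xy by blast
    moreover obtain z where "z \<in> K x"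
      using thick_drawingD(3)[OF dr] xy(1) D(1) by blast
    ultimately show ?thesis
      using absorb[of "K x \<union> A {x, y} \<union> K y" z] that(1) by blast
  qed
  have K: "K x \<subseteq> ?C" if "(d, x) \<in> (R \<inter> D \<times> D)\<^sup>*" for x
    using that
  proof (induction rule: rtrancl_induct)
    case base
    have "p \<in> ?U"
      using p D(2) by blast
    then have "p \<in> ?C"
      by (simp add: connected_component_refl)
    moreover have "K d \<subseteq> ?U"
      using D(2) by blast
    ultimately show ?case
      using absorb[OF conK[OF D(2)] _ p] by blast
  next
    case (step x y)
    then show ?case
      using edge[of x y] by blast
  qed
  have "?U \<subseteq> ?C"
  proof (intro Un_least UN_least)
    show "K x \<subseteq> ?C" if "x \<in> D" for x
      using K conn that by blast
    show "(case e of (x, y) \<Rightarrow> A {x, y}) \<subseteq> ?C" if "e \<in> R \<inter> D \<times> D" for e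
    proof -
      obtain x y where e: "e = (x, y)"
        by fastforce
      then have "K x \<subseteq> ?C"
        using K conn that by blast
      then show ?thesis
        using edge[of x y] that e by auto
    qed
  qed
  then have "?U = ?C"
    by (intro equalityI connected_component_subset)
  then show ?thesis
    by (metis connected_connected_component)
qed

text \<open>The sides are \<open>i, j, k\<close> and \<open>y, z, D\<close>. The set
  \<open>N a\<close> is the whole drawing of \<open>D\<close> plus one edge from \<open>D\<close> to
  \<open>a\<close>. These three sets overlap in the drawing of \<open>D\<close>, which is why
  overlaps among the \<open>N a\<close> have to be permitted.\<close>

lemma thick_drawing_no_K33:
  assumes dr: "thick_drawing V R K A" and R: "R \<subseteq> V \<times> V" "sym R"
    and dist: "i \<noteq> j" "i \<noteq> k" "j \<noteq> k" "y \<noteq> z" "y \<notin> {i, j, k}" "z \<notin> {i, j, k}"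
    and D: "D \<subseteq> V - {i, j, k, y, z}" "d \<in> D" "\<And>x. x \<in> D \<Longrightarrow> (d, x) \<in> (R \<inter> D \<times> D)\<^sup>*"
    and adj: "\<And>a. a \<in> {i, j, k} \<Longrightarrow> (y, a) \<in> R \<and> (z, a) \<in> R \<and> (\<exists>x\<in>D. (x, a) \<in> R)"
  shows False
proof -
  obtain f where f: "\<And>a. a \<in> {i, j, k} \<Longrightarrow> f a \<in> D \<and> (f a, a) \<in> R"
    using adj by metis
  define U where "U = (\<Union>x\<in>D. K x) \<union> (\<Union>(x, y)\<in>R \<inter> D \<times> D. A {x, y})"
  have conU: "connected U"
    unfolding U_def using connected_thick_union[OF dr _ D(2,3)] D(1) by blast
  have V: "y \<in> V" "z \<in> V" "\<And>a. a \<in> {i, j, k} \<Longrightarrow> a \<in> V"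
    using adj R(1) by blast+
  have ne: "a \<noteq> y" "a \<noteq> z" "a \<notin> D" if "a \<in> {i, j, k}" for a
    using that dist D(1) by blast+
  have yzD: "y \<notin> D" "z \<notin> D"
    using D(1) by blast+
  have Ra: "(y, a) \<in> R" "(z, a) \<in> R" "(f a, a) \<in> R" "f a \<in> D" if "a \<in> {i, j, k}" for a
    using adj[OF that] f[OF that] by simp_all
  have AA: "A {u, v} \<inter> A {x, w} = {}"
    if "(u, v) \<in> R" "(x, w) \<in> R" "u \<noteq> x" "u \<noteq> w" "v \<noteq> x" "v \<noteq> w" for u v x w
  proof -
    have "{u, v} \<noteq> {x, w}" "{u, v} \<inter> {x, w} = {}"
      using that by auto
    then show ?thesis
      using thick_drawingD(10)[OF dr that(1,2)] by simp
  qed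
  have UK: "U \<inter> K w = {}" if "w \<in> V" "w \<notin> D" for w
  proof -
    have "K x \<inter> K w = {}" if "x \<in> D" for x
      using thick_drawingD(4)[OF dr, of x w] that \<open>w \<in> V\<close> \<open>w \<notin> D\<close> D(1) by blast
    moreover have "A {x, x'} \<inter> K w = {}" if "(x, x') \<in> R" "x \<in> D" "x' \<in> D" for x x'
      using thick_drawingD(9)[OF dr that(1), of w] that \<open>w \<in> V\<close> \<open>w \<notin> D\<close> by blast
    ultimately show ?thesis
      unfolding U_def by fast
  qed
  have UA: "U \<inter> A {u, v} = {}" if "(u, v) \<in> R" "u \<notin> D" "v \<notin> D" for u v
  proof -
    have "A {u, v} \<inter> K x = {}" if "x \<in> D" for x
      using thick_drawingD(9)[OF dr \<open>(u, v) \<in> R\<close>, of x] that \<open>u \<notin> D\<close> \<open>v \<notin> D\<close> D(1) by blast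
    moreover have "A {u, v} \<inter> A {x, x'} = {}" if "(x, x') \<in> R" "x \<in> D" "x' \<in> D" for x x'
      using AA[OF \<open>(u, v) \<in> R\<close> that(1)] that \<open>u \<notin> D\<close> \<open>v \<notin> D\<close> by blast
    ultimately show ?thesis
      unfolding U_def by fast
  qed
  have AyAy: "A {y, a} \<inter> A {y, b} \<subseteq> K y" "A {z, a} \<inter> A {z, b} \<subseteq> K z"
    if "a \<in> {i, j, k}" "b \<in> {i, j, k}" "a \<noteq> b" for a b
  proof -
    have *: "{y, a} \<noteq> {y, b}" "{y, a} \<inter> {y, b} = {y}" "{z, a} \<noteq> {z, b}" "{z, a} \<inter> {z, b} = {z}"
      using that(3) ne[OF that(1)] ne[OF that(2)] by (auto simp: doubleton_eq_iff)
    show "A {y, a} \<inter> A {y, b} \<subseteq> K y" "A {z, a} \<inter> A {z, b} \<subseteq> K z"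
      using thick_drawingD(10)[OF dr Ra(1)[OF that(1)] Ra(1)[OF that(2)]]
        thick_drawingD(10)[OF dr Ra(2)[OF that(1)] Ra(2)[OF that(2)]] unfolding *(2,4) using *(1,3)
      by simp_all
  qed
  obtain n where n: "n \<in> K d"
    using thick_drawingD(3)[OF dr] D(1,2) by blast
  show False
  proof (rule no_thick_K33[OF dist(1-3), of "K y" "K z" K "\<lambda>a. A {y, a}" "\<lambda>a. A {z, a}"
        "\<lambda>a. U \<union> A {f a, a}" n])
    show "path_connected (K y)" "closed (K y)" "path_connected (K z)" "closed (K z)" "K y \<inter> K z = {}"
      using thick_drawingD[OF dr] V dist(4) by simp_all
  next
    fix a assume a: "a \<in> {i, j, k}"
    note Ra = Ra[OF a] and Va = V(3)[OF a] and ne = ne[OF a]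
    show "path_connected (K a) \<and> K a \<inter> K y = {} \<and> K a \<inter> K z = {}"
      using thick_drawingD(1,4)[OF dr] V(1,2) Va ne by simp
    show "path_connected (A {y, a}) \<and> A {y, a} \<inter> K y \<noteq> {} \<and> A {y, a} \<inter> K a \<noteq> {} \<and> A {y, a} \<inter> K z = {}"
      using thick_drawingD(5,7,8)[OF dr Ra(1)] thick_drawingD(9)[OF dr Ra(1) V(2)] dist(4) ne by simp
    show "path_connected (A {z, a}) \<and> A {z, a} \<inter> K z \<noteq> {} \<and> A {z, a} \<inter> K a \<noteq> {} \<and> A {z, a} \<inter> K y = {}"
      using thick_drawingD(5,7,8)[OF dr Ra(2)] thick_drawingD(9)[OF dr Ra(2) V(1)] dist(4) ne by simp
    have "{y, a} \<noteq> {z, a}" "{y, a} \<inter> {z, a} = {a}"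
      using dist(4) ne by (auto simp: doubleton_eq_iff)
    then show "A {y, a} \<inter> A {z, a} \<subseteq> K a"
      using thick_drawingD(10)[OF dr Ra(1,2)] by (metis image_empty image_insert ccpo_Sup_singleton)
    have "K (f a) \<subseteq> U"
      using Ra(4) unfolding U_def by blast
    then have "U \<inter> A {f a, a} \<noteq> {}"
      using thick_drawingD(7)[OF dr Ra(3)] by blast
    then have "connected (U \<union> A {f a, a})"
      using conU path_connected_imp_connected[OF thick_drawingD(5)[OF dr Ra(3)]] by (intro connected_Un)
    moreover have "n \<in> U"
      using n D(2) unfolding U_def by blast
    moreover have "A {f a, a} \<inter> K y = {}" "A {f a, a} \<inter> K z = {}"
      using thick_drawingD(9)[OF dr Ra(3)] V(1,2) yzD Ra(4) ne by metis+
    ultimately show "connected (U \<union> A {f a, a}) \<and> n \<in> U \<union> A {f a, a} \<and> (U \<union> A {f a, a}) \<inter> K a \<noteq> {} \<and>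
        (U \<union> A {f a, a}) \<inter> K y = {} \<and> (U \<union> A {f a, a}) \<inter> K z = {}"
      using thick_drawingD(8)[OF dr Ra(3)] UK[OF V(1) yzD(1)] UK[OF V(2) yzD(2)]
      by (simp add: Int_Un_distrib2)
  next
    fix a b assume ab: "a \<in> {i, j, k}" "b \<in> {i, j, k}" "a \<noteq> b"
    note Rb = Ra[OF ab(2)] and Vb = V(3)[OF ab(2)] and neb = ne[OF ab(2)]
    note Ra = Ra[OF ab(1)] and Va = V(3)[OF ab(1)] and nea = ne[OF ab(1)]
    have fa: "f a \<noteq> y" "f a \<noteq> z" "f a \<noteq> b"
      using Ra(4) yzD neb(3) by metis+
    have "K a \<inter> K b = {}"
      using thick_drawingD(4)[OF dr Va Vb ab(3)] .
    moreover have "A {y, a} \<inter> K b = {}" "A {z, a} \<inter> K b = {}" "A {f a, a} \<inter> K b = {}"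
      using thick_drawingD(9)[OF dr Ra(1) Vb] thick_drawingD(9)[OF dr Ra(2) Vb]
        thick_drawingD(9)[OF dr Ra(3) Vb] neb ab(3) fa by metis+
    moreover have "A {y, a} \<inter> A {z, b} = {}"
      using AA[OF Ra(1) Rb(2)] dist(4) nea neb ab(3) by metis
    moreover have "A {f a, a} \<inter> A {y, b} = {}" "A {f a, a} \<inter> A {z, b} = {}"
      using AA[OF Ra(3) Rb(1)] AA[OF Ra(3) Rb(2)] fa nea neb ab(3) by metis+
    moreover have "U \<inter> K b = {}" "U \<inter> A {y, b} = {}" "U \<inter> A {z, b} = {}"
      using UK[OF Vb neb(3)] UA[OF Rb(1) yzD(1) neb(3)] UA[OF Rb(2) yzD(2) neb(3)] .
    ultimately show "K a \<inter> K b = {} \<and> A {y, a} \<inter> K b = {} \<and> A {z, a} \<inter> K b = {} \<and>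
        A {y, a} \<inter> A {z, b} = {} \<and> A {y, a} \<inter> A {y, b} \<subseteq> K y \<and> A {z, a} \<inter> A {z, b} \<subseteq> K z \<and>
        (U \<union> A {f a, a}) \<inter> K b = {} \<and> (U \<union> A {f a, a}) \<inter> A {y, b} = {} \<and>
        (U \<union> A {f a, a}) \<inter> A {z, b} = {}"
      using AyAy[OF ab] by (simp add: Int_Un_distrib2)
  qed
qed

section \<open>Subgraphs and contractions of thick drawings\<close>

lemma thickly_planar_subgraph:
  assumes "thickly_planar V R" "V' \<subseteq> V" "R' \<subseteq> R" "R' \<subseteq> V' \<times> V'" "sym R'"
  shows "thickly_planar V' R'"
proof -
  obtain K A where dr: "thick_drawing V R K A"
    using assms(1) by (auto simp: thickly_planar_def)
  have "thick_drawing V' R' K A"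
    unfolding thick_drawing_def
  proof (intro conjI)
    show "\<forall>v\<in>V'. path_connected (K v) \<and> closed (K v) \<and> K v \<noteq> {}"
      using thick_drawingD(1-3)[OF dr] assms(2) by (simp add: subset_iff)
    show "\<forall>u\<in>V'. \<forall>v\<in>V'. u \<noteq> v \<longrightarrow> K u \<inter> K v = {}"
      using thick_drawingD(4)[OF dr] assms(2) by (simp add: subset_iff)
    show "\<forall>(u, v)\<in>R'. path_connected (A {u, v}) \<and> closed (A {u, v}) \<and>
        A {u, v} \<inter> K u \<noteq> {} \<and> A {u, v} \<inter> K v \<noteq> {} \<and> (\<forall>w\<in>V' - {u, v}. A {u, v} \<inter> K w = {})"
    proof (intro ballI)
      fix e assume e: "e \<in> R'"
      obtain u v where uv: "e = (u, v)"
        by fastforce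
      then have R: "(u, v) \<in> R"
        using e assms(3) by blast
      show "case e of (u, v) \<Rightarrow> path_connected (A {u, v}) \<and> closed (A {u, v}) \<and>
        A {u, v} \<inter> K u \<noteq> {} \<and> A {u, v} \<inter> K v \<noteq> {} \<and> (\<forall>w\<in>V' - {u, v}. A {u, v} \<inter> K w = {})"
        using thick_drawingD(5-9)[OF dr R] assms(2) unfolding uv by (simp add: subset_iff)
    qed
    show "\<forall>(u, v)\<in>R'. \<forall>(x, y)\<in>R'. {u, v} \<noteq> {x, y} \<longrightarrow>
        A {u, v} \<inter> A {x, y} \<subseteq> \<Union> (K ` ({u, v} \<inter> {x, y}))"
    proof (intro ballI case_prodI2 impI)
      fix e f u v x y assume "e \<in> R'" "e = (u, v)" "f \<in> R'" "f = (x, y)" "{u, v} \<noteq> {x, y}"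
      then show "A {u, v} \<inter> A {x, y} \<subseteq> \<Union> (K ` ({u, v} \<inter> {x, y}))"
        using thick_drawingD(10)[OF dr, of u v x y] assms(3) by (simp add: subset_iff)
    qed
  qed
  moreover have "finite V'" "irrefl R'"
    using assms(1-3) finite_subset by (auto simp: thickly_planar_def irrefl_def)
  ultimately show ?thesis
    using assms(4,5) by (auto simp: thickly_planar_def)
qed

text \<open>The merged vertex \<open>u\<close> is drawn as the union of the two ends and the edge
  between them. Only the neighbours \<open>X\<close> that \<open>v\<close> does not share with
  \<open>u\<close> need a new edge, so one edge of each doubled pair is dropped by construction, and
  every new edge keeps the plane set of an old one.\<close>

lemma thickly_planar_contract:
  assumes "thickly_planar V R" and uv: "(u, v) \<in> R"
  defines "X \<equiv> {x. (v, x) \<in> R \<and> x \<noteq> u \<and> (u, x) \<notin> R}"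
  defines "R' \<equiv> {(x, y) \<in> R. x \<noteq> v \<and> y \<noteq> v} \<union> ({u} \<times> X \<union> X \<times> {u})"
  shows "thickly_planar (V - {v}) R'"
proof -
  obtain K A where dr: "thick_drawing V R K A" and fin: "finite V" and R: "R \<subseteq> V \<times> V" "sym R" "irrefl R"
    using assms(1) by (auto simp: thickly_planar_def)
  have "u \<noteq> v" "u \<in> V" "v \<in> V"
    using uv R by (auto simp: irrefl_def)
  have symR: "(y, x) \<in> R" if "(x, y) \<in> R" for x y
    using R(2) that by (rule symD)
  define K' where "K' = K(u := K u \<union> A {u, v} \<union> K v)"
  \<comment> \<open>For \<open>x \<in> X\<close> this index turns \<open>{u, x}\<close> back into
    the old edge \<open>{v, x}\<close>.\<close>
  define A' where "A' e = (if \<exists>x\<in>X. e = {u, x} then A (insert v (e - {u})) else A e)" for e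
  define \<phi> where "\<phi> w = (if w = v then u else w)" for w
  have Xv: "v \<notin> X" "u \<notin> X"
    using R(3) by (auto simp: X_def irrefl_def)
  have K\<phi>: "K w \<subseteq> K' (\<phi> w)" for w
    by (auto simp: K'_def \<phi>_def)
  have origin: "\<exists>x0 y0. (x0, y0) \<in> R \<and> \<phi> x0 = x \<and> \<phi> y0 = y \<and> {x0, y0} \<noteq> {u, v} \<and> A' {x, y} = A {x0, y0}"
    if xy: "(x, y) \<in> R'" for x y
  proof -
    have AX: "A' {u, w} = A {v, w}" "A' {w, u} = A {w, v}" if "w \<in> X" for w
    proof -
      have "{u, w} - {u} = {w}"
        using Xv that by auto
      then show "A' {u, w} = A {v, w}"
        using that by (auto simp: A'_def)
      then show "A' {w, u} = A {w, v}"
        by (simp add: insert_commute)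
    qed
    consider "(x, y) \<in> R" "x \<noteq> v" "y \<noteq> v" | "x = u" "y \<in> X" | "x \<in> X" "y = u"
      using xy by (auto simp: R'_def)
    then show ?thesis
    proof cases
      case 1
      have "\<not> (\<exists>w\<in>X. {x, y} = {u, w})"
        using 1 symR by (auto simp: X_def doubleton_eq_iff)
      then have "A' {x, y} = A {x, y}"
        by (simp add: A'_def)
      moreover have "{x, y} \<noteq> {u, v}"
        using 1 by (auto simp: doubleton_eq_iff)
      ultimately show ?thesis
        using 1 by (intro exI[of _ x] exI[of _ y]) (simp add: \<phi>_def)
    next
      case 2
      then have "(v, y) \<in> R" "y \<noteq> u" "y \<noteq> v" "A' {x, y} = A {v, y}"
        using AX Xv by (auto simp: X_def)
      then show ?thesis
        using 2 by (intro exI[of _ v] exI[of _ y]) (auto simp: \<phi>_def doubleton_eq_iff)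
    next
      case 3
      then have "(x, v) \<in> R" "x \<noteq> u" "x \<noteq> v" "A' {x, y} = A {x, v}"
        using AX Xv symR by (auto simp: X_def)
      then show ?thesis
        using 3 by (intro exI[of _ x] exI[of _ v]) (auto simp: \<phi>_def doubleton_eq_iff)
    qed
  qed
  have "thick_drawing (V - {v}) R' K' A'"
    unfolding thick_drawing_def
  proof (intro conjI)
    have "path_connected (K u \<union> A {u, v} \<union> K v)"
      using thick_drawingD(1,5)[OF dr] thick_drawingD(7,8)[OF dr uv] \<open>u \<in> V\<close> \<open>v \<in> V\<close> uv
      by (intro path_connected_Un) (simp_all add: Int_commute Int_Un_distrib)
    moreover have "closed (K u \<union> A {u, v} \<union> K v)"
      using thick_drawingD(2,6)[OF dr] \<open>u \<in> V\<close> \<open>v \<in> V\<close> uv by (intro closed_Un)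
    ultimately show "\<forall>w\<in>V - {v}. path_connected (K' w) \<and> closed (K' w) \<and> K' w \<noteq> {}"
      using thick_drawingD(1-3)[OF dr] \<open>u \<in> V\<close> by (simp add: K'_def)
  next
    have "(K u \<union> A {u, v} \<union> K v) \<inter> K w = {}" if "w \<in> V" "w \<noteq> u" "w \<noteq> v" for w
      using thick_drawingD(4)[OF dr \<open>u \<in> V\<close> that(1)] thick_drawingD(4)[OF dr \<open>v \<in> V\<close> that(1)]
        thick_drawingD(9)[OF dr uv that(1)] that(2,3) by (simp add: Int_Un_distrib2)
    then show "\<forall>x\<in>V - {v}. \<forall>y\<in>V - {v}. x \<noteq> y \<longrightarrow> K' x \<inter> K' y = {}"
      using thick_drawingD(4)[OF dr] by (simp add: K'_def Int_commute)
  next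
    show "\<forall>(x, y)\<in>R'. path_connected (A' {x, y}) \<and> closed (A' {x, y}) \<and> A' {x, y} \<inter> K' x \<noteq> {} \<and>
        A' {x, y} \<inter> K' y \<noteq> {} \<and> (\<forall>w\<in>V - {v} - {x, y}. A' {x, y} \<inter> K' w = {})"
    proof (intro ballI)
      fix e assume "e \<in> R'"
      moreover obtain x y where e: "e = (x, y)"
        by fastforce
      ultimately have "(x, y) \<in> R'"
        by simp
      then obtain x0 y0 where o: "(x0, y0) \<in> R" "\<phi> x0 = x" "\<phi> y0 = y" "{x0, y0} \<noteq> {u, v}"
          "A' {x, y} = A {x0, y0}"
        using origin by blast
      have "A' {x, y} \<inter> K' x \<noteq> {}" "A' {x, y} \<inter> K' y \<noteq> {}"
        using thick_drawingD(7,8)[OF dr o(1)] K\<phi>[of x0] K\<phi>[of y0] unfolding o(2,3,5) by blast+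
      moreover have "A' {x, y} \<inter> K' w = {}" if w: "w \<in> V - {v} - {x, y}" for w
      proof (cases "w = u")
        case True
        then have *: "x0 \<noteq> u" "x0 \<noteq> v" "y0 \<noteq> u" "y0 \<noteq> v"
          using w o(2,3) by (auto simp: \<phi>_def split: if_splits)
        \<comment> \<open>An edge that does not end at \<open>u\<close> after the contraction ended
          at neither \<open>u\<close> nor \<open>v\<close> before, so it misses all three pieces of
          \<open>K' u\<close>.\<close>
        then have "{x0, y0} \<inter> {u, v} = {}"
          by auto
        then have "A {x0, y0} \<inter> A {u, v} = {}"
          using thick_drawingD(10)[OF dr o(1) uv o(4)] by simp
        then show ?thesis
          using thick_drawingD(9)[OF dr o(1) \<open>u \<in> V\<close>] thick_drawingD(9)[OF dr o(1) \<open>v \<in> V\<close>] * True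
          unfolding o(5) by (simp add: K'_def Int_Un_distrib)
      next
        case False
        then have "w \<noteq> x0" "w \<noteq> y0" "w \<in> V"
          using w o(2,3) by (auto simp: \<phi>_def split: if_splits)
        then show ?thesis
          using thick_drawingD(9)[OF dr o(1)] False unfolding o(5) by (simp add: K'_def)
      qed
      ultimately show "case e of (x, y) \<Rightarrow> path_connected (A' {x, y}) \<and> closed (A' {x, y}) \<and>
        A' {x, y} \<inter> K' x \<noteq> {} \<and> A' {x, y} \<inter> K' y \<noteq> {} \<and> (\<forall>w\<in>V - {v} - {x, y}. A' {x, y} \<inter> K' w = {})"
        using thick_drawingD(5,6)[OF dr o(1)] o(5) unfolding e by simp
    qed
  next
    show "\<forall>(x, y)\<in>R'. \<forall>(a, b)\<in>R'. {x, y} \<noteq> {a, b} \<longrightarrow>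
        A' {x, y} \<inter> A' {a, b} \<subseteq> \<Union> (K' ` ({x, y} \<inter> {a, b}))"
    proof (intro ballI case_prodI2 impI)
      fix e f x y a b assume "e \<in> R'" "e = (x, y)" "f \<in> R'" "f = (a, b)" and ne: "{x, y} \<noteq> {a, b}"
      then obtain x0 y0 a0 b0 where o: "(x0, y0) \<in> R" "\<phi> x0 = x" "\<phi> y0 = y" "A' {x, y} = A {x0, y0}"
          "(a0, b0) \<in> R" "\<phi> a0 = a" "\<phi> b0 = b" "A' {a, b} = A {a0, b0}"
        using origin[of x y] origin[of a b] by blast
      have im: "\<phi> ` {x0, y0} = {x, y}" "\<phi> ` {a0, b0} = {a, b}"
        using o by auto
      \<comment> \<open>The map \<open>\<phi>\<close> sends old ends to new ends, so different new
        edges come from different old ones, and common old ends go to common new ends.\<close>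
      then have "{x0, y0} \<noteq> {a0, b0}"
        using ne by metis
      then have "A' {x, y} \<inter> A' {a, b} \<subseteq> \<Union> (K ` ({x0, y0} \<inter> {a0, b0}))"
        using thick_drawingD(10)[OF dr o(1,5)] o(4,8) by simp
      also have "\<dots> \<subseteq> \<Union> (K' ` (\<phi> ` ({x0, y0} \<inter> {a0, b0})))"
        using K\<phi> by blast
      also have "\<dots> \<subseteq> \<Union> (K' ` ({x, y} \<inter> {a, b}))"
        unfolding im[symmetric] by (intro Union_mono image_mono image_Int_subset)
      finally show "A' {x, y} \<inter> A' {a, b} \<subseteq> \<Union> (K' ` ({x, y} \<inter> {a, b}))" .
    qed
  qed
  moreover have "R' \<subseteq> (V - {v}) \<times> (V - {v})"
    using R(1) Xv \<open>u \<in> V\<close> \<open>u \<noteq> v\<close> by (auto simp: R'_def X_def)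
  moreover have "sym R'"
    using symR by (auto simp: R'_def sym_def)
  moreover have "irrefl R'"
    using R(3) Xv by (auto simp: R'_def irrefl_def)
  ultimately show ?thesis
    using fin by (auto simp: thickly_planar_def)
qed

subsection \<open>The edge bound\<close>

text \<open>Contracting \<open>uv\<close> loses the edge \<open>uv\<close> itself and one edge per
  common neighbour, where two edges become parallel; each counts twice because \<open>R\<close>
  holds both orientations.\<close>

lemma card_contracted_arcs:
  assumes fin: "finite R" and R: "sym R" "irrefl R" and uv: "(u, v) \<in> R"
  defines "X \<equiv> {x. (v, x) \<in> R \<and> x \<noteq> u \<and> (u, x) \<notin> R}"
  defines "R' \<equiv> {(x, y) \<in> R. x \<noteq> v \<and> y \<noteq> v} \<union> ({u} \<times> X \<union> X \<times> {u})"
  shows "card R = card R' + 2 * card (R `` {u} \<inter> R `` {v}) + 2"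
proof -
  define R0 where "R0 = {(x, y) \<in> R. x \<noteq> v \<and> y \<noteq> v}"
  have symR: "(y, x) \<in> R" if "(x, y) \<in> R" for x y
    using R(1) that by (rule symD)
  have irr: "(x, x) \<notin> R" for x
    using R(2) by (simp add: irrefl_def)
  have finN: "finite (R `` {w})" for w
    using fin by (rule finite_Image)
  have finX: "finite X"
    by (rule finite_subset[OF _ finN[of v]]) (auto simp: X_def)
  have fin0: "finite R0"
    by (rule finite_subset[OF _ fin]) (auto simp: R0_def)
  \<comment> \<open>The neighbours of \<open>v\<close> are \<open>u\<close>, those shared with
    \<open>u\<close>, and \<open>X\<close>.\<close>
  have "R `` {v} = insert u ((R `` {u} \<inter> R `` {v}) \<union> X)"
    using symR[OF uv] by (auto simp: X_def)
  moreover have "u \<notin> (R `` {u} \<inter> R `` {v}) \<union> X" "(R `` {u} \<inter> R `` {v}) \<inter> X = {}"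
    using irr by (auto simp: X_def)
  moreover have "finite (R `` {u} \<inter> R `` {v})"
    using finN by blast
  ultimately have deg: "card (R `` {v}) = Suc (card (R `` {u} \<inter> R `` {v}) + card X)"
    using finX by (metis card_Un_disjoint card_insert_disjoint finite_UnI)
  have "R = R0 \<union> ({v} \<times> R `` {v} \<union> R `` {v} \<times> {v})"
    using symR by (auto simp: R0_def)
  then have "card R = card (R0 \<union> ({v} \<times> R `` {v} \<union> R `` {v} \<times> {v}))"
    by (rule arg_cong)
  also have "\<dots> = card R0 + (card (R `` {v}) + card (R `` {v}))"
    using irr fin0 finN
    by (subst card_Un_disjoint, simp, simp, force simp: R0_def)
       (subst card_Un_disjoint; auto simp: card_cartesian_product)
  finally have cR: "card R = card R0 + 2 * card (R `` {v})"
    by simp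
  have "card R' = card R0 + (card X + card X)"
    unfolding R'_def R0_def[symmetric] using irr fin0 finX symR
    by (subst card_Un_disjoint, simp, simp, force simp: R0_def X_def)
       (subst card_Un_disjoint; auto simp: card_cartesian_product X_def)
  then show ?thesis
    using cR deg by simp
qed

lemma card_eq_sum_degrees:
  assumes "finite V" "R \<subseteq> V \<times> V"
  shows "card R = (\<Sum>v\<in>V. card (R `` {v}))"
proof -
  have "R = Sigma V (\<lambda>v. R `` {v})"
    using assms(2) by auto
  moreover have "finite (R `` {v})" for v
    using assms finite_subset[of R "V \<times> V"] by (simp add: finite_Image)
  ultimately show ?thesis
    using card_SigmaI[of V "\<lambda>v. R `` {v}"] assms(1) by simp
qed

text \<open>Mader's argument: in a minimal counterexample every edge lies in three triangles, so that a
  vertex of degree at most five has a dense neighbourhood. Degree five gives a \<open>K33\<close> at once,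
  degree four a \<open>K5\<close>; a component of the complement of the latter with three attachments gives a
  \<open>K33\<close>, and one with at most two attachments can be split off.\<close>

theorem thickly_planar_card_arcs:
  assumes "thickly_planar V R" "2 \<le> card V"
  shows "card R + 10 \<le> 6 * card V"
  using assms
\<comment> \<open>Since \<open>R\<close> holds both orientations, the claim is |E| \<le> 3n - 5. The
  measure drops under contractions as well as under passage to proper subgraphs.\<close>
proof (induction "card V + card R" arbitrary: V R rule: less_induct)
  case less
  obtain K A where dr: "thick_drawing V R K A" and finV: "finite V" and R: "R \<subseteq> V \<times> V" "sym R" "irrefl R"
    using less.prems(1) by (auto simp: thickly_planar_def)
  have finR: "finite R"
    using finite_subset[OF R(1)] finV by simp
  have symR: "(y, x) \<in> R" if "(x, y) \<in> R" for x y
    using R(2) that by (rule symD)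
  have irr: "(x, x) \<notin> R" for x
    using R(3) by (simp add: irrefl_def)
  have finN: "finite (R `` {w})" for w
    using finR by (rule finite_Image)
  have IH_sub: "card R' + 10 \<le> 6 * card V'"
    if "V' \<subseteq> V" "R' \<subseteq> R" "R' \<subseteq> V' \<times> V'" "sym R'" "V' \<noteq> V \<or> R' \<noteq> R" "2 \<le> card V'" for V' R'
  proof (rule less.hyps)
    have "card V' \<le> card V" "card R' \<le> card R"
      using that finV finR by (simp_all add: card_mono)
    moreover have "card V' < card V \<or> card R' < card R"
      using that(1,2,5) finV finR by (meson psubset_card_mono psubsetI)
    ultimately show "card V' + card R' < card V + card R"
      by linarith
    show "thickly_planar V' R'"
      using thickly_planar_subgraph[OF less.prems(1)] that by blast
  qed fact
  show ?case
  proof (rule ccontr)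
    assume "\<not> ?thesis"
    then have big: "6 * card V < card R + 10"
      by simp
    have "R \<noteq> {}"
      using big less.prems(2) by auto
    then obtain a b where ab: "(a, b) \<in> R"
      by auto
    have irrefl_bound: "card R \<le> card V * card V - card V"
    proof -
      have "R \<subseteq> V \<times> V - (\<lambda>x. (x, x)) ` V"
        using R(1) irr by auto
      then have "card R \<le> card (V \<times> V - (\<lambda>x. (x, x)) ` V)"
        using finV by (intro card_mono) auto
      also have "\<dots> = card V * card V - card V"
        using finV by (subst card_Diff_subset) (auto simp: card_cartesian_product card_image inj_on_def)
      finally show ?thesis .
    qed
    have n3: "3 \<le> card V"
    proof (rule ccontr)
      assume "\<not> 3 \<le> card V"
      then have "card V = 2"
        using less.prems(2) by simp
      then show False
        using irrefl_bound big by simp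
    qed
    \<comment> \<open>Deleting one edge restores the bound by minimality, so |E| \<le> 3n - 4. This
      keeps the average degree below 6.\<close>
    have small: "card R + 8 \<le> 6 * card V"
    proof -
      have "a \<noteq> b"
        using ab irr by metis
      then have "card (R - {(a, b), (b, a)}) + 2 = card R"
        using ab symR[OF ab] finR card_Diff_subset[of "{(a, b), (b, a)}" R] card_mono[of R "{(a, b), (b, a)}"]
        by simp
      moreover have "card (R - {(a, b), (b, a)}) + 10 \<le> 6 * card V"
        using R(1,2) ab less.prems(2) by (intro IH_sub) (auto simp: sym_def)
      ultimately show ?thesis
        by simp
    qed
    \<comment> \<open>With t common neighbours the contraction gives |E| \<le> 3(n - 1) - 5 + 1 + t,
      which is at most 3n - 5 unless t \<ge> 3.\<close>
    have triangles: "3 \<le> card (R `` {u} \<inter> R `` {v})" if uv: "(u, v) \<in> R" for u v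
    proof -
      define X where "X = {x. (v, x) \<in> R \<and> x \<noteq> u \<and> (u, x) \<notin> R}"
      define R' where "R' = {(x, y) \<in> R. x \<noteq> v \<and> y \<noteq> v} \<union> ({u} \<times> X \<union> X \<times> {u})"
      have tp: "thickly_planar (V - {v}) R'"
        unfolding R'_def X_def by (rule thickly_planar_contract[OF less.prems(1) uv])
      have c: "card R = card R' + 2 * card (R `` {u} \<inter> R `` {v}) + 2"
        unfolding R'_def X_def by (rule card_contracted_arcs[OF finR R(2,3) uv])
      have "v \<in> V"
        using uv R(1) by blast
      then have cV: "card V = card (V - {v}) + 1"
        using n3 finV by (simp add: card_Diff_singleton)
      then have "card R' + 10 \<le> 6 * card (V - {v})"
        using c n3 by (intro less.hyps[OF _ tp]) linarith+
      then show ?thesis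
        using c cV big by linarith
    qed
    have "\<exists>v\<in>V. card (R `` {v}) \<le> 5"
    proof (rule ccontr)
      assume "\<not> ?thesis"
      then have "(\<Sum>v\<in>V. 6) \<le> (\<Sum>v\<in>V. card (R `` {v}))"
        by (intro sum_mono) force
      then show False
        using card_eq_sum_degrees[OF finV R(1)] small by simp
    qed
    then obtain v where v: "v \<in> V" "card (R `` {v}) \<le> 5"
      by blast
    define N where "N = R `` {v}"
    have N: "finite N" "card N \<le> 5" "N \<subseteq> V" "v \<notin> N"
      using v finN R(1) irr by (auto simp: N_def)
    have vN: "(v, x) \<in> R" "(x, v) \<in> R" if "x \<in> N" for x
      using that symR by (auto simp: N_def)
    have NN: "3 \<le> card (R `` {u} \<inter> N)" if "u \<in> N" for u
      using triangles[OF vN(2)[OF that]] by (simp add: N_def)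
    have "N \<noteq> {}"
    proof
      assume "N = {}"
      then have "R \<subseteq> (V - {v}) \<times> (V - {v})"
        using R(1) symR by (auto simp: N_def)
      moreover have "2 \<le> card (V - {v})"
        using n3 v(1) finV by (simp add: card_Diff_singleton)
      ultimately have "card R + 10 \<le> 6 * card (V - {v})"
        using v(1) R(2) by (intro IH_sub) auto
      then show False
        using big card_Diff1_le[of V v] by linarith
    qed
    have NNsub: "R `` {u} \<inter> N \<subseteq> N - {u}" for u
      using irr by auto
    have "4 \<le> card N"
    proof -
      obtain u where u: "u \<in> N"
        using \<open>N \<noteq> {}\<close> by blast
      have "3 \<le> card (N - {u})"
        using NN[OF u] card_mono[OF _ NNsub[of u]] N(1) by force
      then show ?thesis
        using u N(1) by (simp add: card_Diff_singleton)
    qed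
    then consider "card N = 5" | "card N = 4"
      using N(2) by linarith
    then show False
    proof cases
      case 1
      \<comment> \<open>Within the five neighbours all degrees are at least 3. Two nonadjacent ones
        must both be joined to the remaining three; otherwise \<open>N\<close> is complete. Either
        way \<open>v, y, z\<close> against the other three is a \<open>K33\<close>.\<close>
      have "\<exists>y z. y \<in> N \<and> z \<in> N \<and> y \<noteq> z \<and> (\<forall>x\<in>N - {y, z}. (y, x) \<in> R \<and> (z, x) \<in> R)"
      proof (cases "\<exists>y z. y \<in> N \<and> z \<in> N \<and> y \<noteq> z \<and> (y, z) \<notin> R")
        case True
        then obtain y z where yz: "y \<in> N" "z \<in> N" "y \<noteq> z" "(y, z) \<notin> R"
          by blast
        then have "(z, y) \<notin> R"
          using symR by blast
        have c: "card (N - {y, z}) = 3"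
          using yz 1 N(1) by (simp add: card_Diff_subset)
        have "R `` {y} \<inter> N \<subseteq> N - {y, z}" "R `` {z} \<inter> N \<subseteq> N - {y, z}"
          using yz \<open>(z, y) \<notin> R\<close> irr by auto
        then have "R `` {y} \<inter> N = N - {y, z}" "R `` {z} \<inter> N = N - {y, z}"
          using NN[OF yz(1)] NN[OF yz(2)] c N(1) by (metis card_seteq finite_Diff)+
        then show ?thesis
          using yz by blast
      next
        case False
        obtain y where y: "y \<in> N"
          using \<open>N \<noteq> {}\<close> by blast
        have "card (N - {y}) = 4"
          using 1 y by simp
        then have "N - {y} \<noteq> {}"
          by fastforce
        then obtain z where "z \<in> N" "z \<noteq> y"
          by blast
        then show ?thesis
          using False y by blast
      qed
      then obtain y z where yz: "y \<in> N" "z \<in> N" "y \<noteq> z"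
        and adj: "\<And>x. x \<in> N - {y, z} \<Longrightarrow> (y, x) \<in> R \<and> (z, x) \<in> R"
        by blast
      have "card (N - {y, z}) = 3"
        using yz 1 N(1) by (simp add: card_Diff_subset)
      then obtain i j k where ijk: "N - {y, z} = {i, j, k}" "i \<noteq> j" "i \<noteq> k" "j \<noteq> k"
        by (auto simp: card_3_iff)
      have sub: "{i, j, k} \<subseteq> N" "y \<notin> {i, j, k}" "z \<notin> {i, j, k}"
        unfolding ijk(1)[symmetric] by auto
      show False
      proof (rule thick_drawing_no_K33[OF dr R(1,2) ijk(2-4) yz(3) sub(2,3), of "{v}" v])
        show "{v} \<subseteq> V - {i, j, k, y, z}"
          using v(1) N(4) sub(1) yz(1,2) by blast
        show "(y, x) \<in> R \<and> (z, x) \<in> R \<and> (\<exists>x'\<in>{v}. (x', x) \<in> R)" if "x \<in> {i, j, k}" for x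
          using adj[of x] vN(1)[of x] that sub(1) unfolding ijk(1) by blast
      qed auto
    next
      case 2
      \<comment> \<open>Three neighbours among three candidates: \<open>v\<close> and
        \<open>N\<close> span a K5.\<close>
      have complete: "(x, y) \<in> R" if "x \<in> N" "y \<in> N" "x \<noteq> y" for x y
      proof -
        have "card (N - {x}) = 3"
          using that(1) 2 N(1) by simp
        then have "R `` {x} \<inter> N = N - {x}"
          using NN[OF that(1)] NNsub N(1) by (metis card_seteq finite_Diff)
        then show ?thesis
          using that by blast
      qed
      define W where "W = V - insert v N"
      \<comment> \<open>K5 alone attains the bound, 20 + 10 = 6 * 5, and is no
        counterexample.\<close>
      have "W \<noteq> {}"
      proof
        assume "W = {}"
        then have "V = insert v N"
          using v(1) N(3) by (auto simp: W_def)
        then have "card V = 5"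
          using 2 N(1,4) by simp
        then show False
          using irrefl_bound big by simp
      qed
      then obtain d where d: "d \<in> W"
        by blast
      \<comment> \<open>\<open>D\<close> is the component of \<open>d\<close> in the complement of
        the K5. Its attachments \<open>T\<close> are in \<open>N\<close>, as \<open>v\<close> has no
        neighbour outside \<open>N\<close>.\<close>
      define D where "D = {x. (d, x) \<in> (R \<inter> W \<times> W)\<^sup>*}"
      have dD: "d \<in> D"
        by (simp add: D_def)
      have DW: "D \<subseteq> W"
      proof
        fix x assume "x \<in> D"
        then have "(d, x) \<in> (R \<inter> W \<times> W)\<^sup>*"
          by (simp add: D_def)
        then show "x \<in> W"
          by (induction rule: rtrancl_induct) (use d in auto)
      qed
      have closedD: "y \<in> D" if "x \<in> D" "(x, y) \<in> R" "y \<in> W" for x y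
        using that DW unfolding D_def by (auto intro: rtrancl_into_rtrancl)
      have connD: "(d, x) \<in> (R \<inter> D \<times> D)\<^sup>*" if "x \<in> D" for x
      proof -
        have "(d, x) \<in> (R \<inter> W \<times> W)\<^sup>*"
          using that by (simp add: D_def)
        then show ?thesis
        proof (induction rule: rtrancl_induct)
          case (step x y)
          have "x \<in> D" "y \<in> D"
            using step(1,2) by (auto simp: D_def intro: rtrancl_into_rtrancl)
          then show ?case
            using step(2,3) by (auto intro: rtrancl_into_rtrancl)
        qed simp
      qed
      define T where "T = {q \<in> N. \<exists>x\<in>D. (x, q) \<in> R}"
      have TN: "T \<subseteq> N" "finite T"
        using N(1) by (auto simp: T_def)
      show False
      proof (cases "3 \<le> card T")
        case True
        then obtain S where S: "S \<subseteq> T" "card S = 3"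
          using obtain_subset_with_card_n by metis
        then obtain i j k where ijk: "S = {i, j, k}" "i \<noteq> j" "i \<noteq> k" "j \<noteq> k"
          by (auto simp: card_3_iff)
        \<comment> \<open>The \<open>K33\<close> has three attachments on one side and
          \<open>v\<close>, the fourth vertex \<open>z\<close> of \<open>N\<close>, and
          \<open>D\<close> on the other.\<close>
        have "card (N - S) = 1"
          using S TN N(1) 2 by (subst card_Diff_subset) (auto intro: finite_subset)
        then obtain z where "N - S = {z}"
          by (auto simp: card_1_singleton_iff)
        then have z: "z \<in> N" "z \<notin> {i, j, k}"
          unfolding ijk(1)[symmetric] by auto
        have sub: "{i, j, k} \<subseteq> N"
          using S(1) TN(1) ijk(1) by blast
        have vz: "v \<noteq> z" "v \<notin> {i, j, k}"
          using N(4) z(1) sub by blast+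
        show False
        proof (rule thick_drawing_no_K33[OF dr R(1,2) ijk(2-4) vz(1,2) z(2) _ dD connD])
          show "D \<subseteq> V - {i, j, k, v, z}"
            using DW sub z(1) unfolding W_def by blast
          show "(v, x) \<in> R \<and> (z, x) \<in> R \<and> (\<exists>x'\<in>D. (x', x) \<in> R)" if "x \<in> {i, j, k}" for x
          proof -
            have "x \<in> N" "x \<noteq> z" "x \<in> T"
              using that sub z(2) S(1) ijk(1) by blast+
            then show ?thesis
              using vN(1) complete[OF z(1)] by (auto simp: T_def)
          qed
        qed
      next
        case False
        \<comment> \<open>The attachments are padded to exactly two vertices of the clique
          \<open>N\<close>, so that the parts \<open>V1\<close> and \<open>V2\<close> share an edge
          and have at least two vertices each.\<close>
        then obtain Q where Q: "T \<subseteq> Q" "Q \<subseteq> N" "card Q = 2"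
          using exists_subset_between[of T 2 N] TN N(1) 2 by auto
        then obtain p q where pq: "Q = {p, q}" "p \<noteq> q"
          by (auto simp: card_2_iff)
        define V1 where "V1 = V - D"
        define V2 where "V2 = D \<union> Q"
        define R1 where "R1 = R \<inter> V1 \<times> V1"
        define R2 where "R2 = R \<inter> V2 \<times> V2"
        have DV: "D \<subseteq> V" "v \<notin> D" "D \<inter> Q = {}" "Q \<subseteq> V"
          using DW Q(2) N(3) unfolding W_def by blast+
        have neighbours: "y \<in> V2" if "x \<in> D" "(x, y) \<in> R" for x y
        proof -
          have "y \<noteq> v"
            using that DW symR unfolding W_def N_def by blast
          moreover have "y \<in> V"
            using that R(1) by blast
          ultimately consider "y \<in> W" | "y \<in> N"
            unfolding W_def by blast
          then show ?thesis
          proof cases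
            case 1
            then show ?thesis
              using closedD that by (simp add: V2_def)
          next
            case 2
            then have "y \<in> T"
              using that by (auto simp: T_def)
            then show ?thesis
              using Q(1) by (auto simp: V2_def)
          qed
        qed
        have "R \<subseteq> R1 \<union> R2"
        proof
          fix e assume e: "e \<in> R"
          obtain x y where xy: "e = (x, y)"
            by fastforce
          have "x \<in> V" "y \<in> V"
            using e xy R(1) by auto
          then show "e \<in> R1 \<union> R2"
            using neighbours[of x y] neighbours[of y x] e symR[of x y]
            unfolding xy R1_def R2_def V1_def V2_def by blast
        qed
        then have Rsplit: "R = R1 \<union> R2"
          by (auto simp: R1_def R2_def)
        have "(p, q) \<in> R" "(q, p) \<in> R"
          using complete pq Q(2) by auto
        then have "{(p, q), (q, p)} \<subseteq> R1 \<inter> R2"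
          using DV pq(1) by (auto simp: R1_def R2_def V1_def V2_def)
        moreover have fin12: "finite R1" "finite R2"
          using finR by (auto simp: R1_def R2_def)
        ultimately have "card {(p, q), (q, p)} \<le> card (R1 \<inter> R2)"
          by (intro card_mono) auto
        \<comment> \<open>The shared edge, counted on both sides, closes the count: the parts have n
          + 2 vertices in total, and 6(n + 2) - 20 - 2 = 6n - 10.\<close>
        then have "card R + 2 \<le> card R1 + card R2"
          using card_Un_Int[OF fin12] pq(2) Rsplit by simp
        moreover have "card R1 + 10 \<le> 6 * card V1"
        proof (rule IH_sub)
          have "Q \<subseteq> V1"
            using DV by (auto simp: V1_def)
          then show "2 \<le> card V1"
            using Q(3) card_mono[of V1 Q] finV by (simp add: V1_def)
        qed (use dD DV symR in \<open>auto simp: R1_def V1_def sym_def\<close>)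
        moreover have "card R2 + 10 \<le> 6 * card V2"
        proof (rule IH_sub)
          have "finite V2"
            using finV DV finite_subset by (auto simp: V2_def)
          then show "2 \<le> card V2"
            using Q(3) card_mono[of V2 Q] by (simp add: V2_def)
          have "v \<notin> V2"
            using DV(2) Q(2) N(4) by (auto simp: V2_def)
          then show "V2 \<noteq> V \<or> R2 \<noteq> R"
            using v(1) by blast
        qed (use DV symR in \<open>auto simp: R2_def V2_def sym_def\<close>)
        moreover have "card V1 + card V2 = card V + 2"
        proof -
          have "finite D" "finite Q"
            using finite_subset[OF DV(1) finV] finite_subset[OF DV(4) finV] .
          then show ?thesis
            using finV DV Q(3) card_mono[OF finV DV(1)]
            by (simp add: V1_def V2_def card_Diff_subset card_Un_disjoint)
        qed
        ultimately show False
          using big by linarith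
      qed
    qed
  qed
qed

subsection \<open>Minor minimal nonapex graphs\<close>

lemma planar_thickly_planar:
  assumes "finite (verts H)" "arcs_ends H \<subseteq> verts H \<times> verts H" "sym (arcs_ends H)" "irrefl (arcs_ends H)"
    and "planar H"
  shows "thickly_planar (verts H) (arcs_ends H)"
proof -
  obtain p \<gamma> where "plane_drawing H p \<gamma>"
    using assms(5) by (auto simp: planar_def)
  then have inj: "inj_on p (verts H)"
    and edge: "\<forall>(u, v)\<in>arcs_ends H. arc (\<gamma> {u, v}) \<and>
        {pathstart (\<gamma> {u, v}), pathfinish (\<gamma> {u, v})} = {p u, p v} \<and>
        path_image (\<gamma> {u, v}) \<inter> p ` verts H = {p u, p v}"
    and cross: "\<forall>(u, v)\<in>arcs_ends H. \<forall>(x, y)\<in>arcs_ends H. {u, v} \<noteq> {x, y} \<longrightarrow>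
        path_image (\<gamma> {u, v}) \<inter> path_image (\<gamma> {x, y}) \<subseteq> p ` ({u, v} \<inter> {x, y})"
    unfolding plane_drawing_def by - (elim conjE, assumption)+
  have "thick_drawing (verts H) (arcs_ends H) (\<lambda>v. {p v}) (\<lambda>e. path_image (\<gamma> e))"
    unfolding thick_drawing_def
  proof (intro conjI)
    show "\<forall>v\<in>verts H. path_connected {p v} \<and> closed {p v} \<and> {p v} \<noteq> {}"
      by simp
    show "\<forall>u\<in>verts H. \<forall>v\<in>verts H. u \<noteq> v \<longrightarrow> {p u} \<inter> {p v} = {}"
      using inj by (auto dest: inj_onD)
    show "\<forall>(u, v)\<in>arcs_ends H. path_connected (path_image (\<gamma> {u, v})) \<and> closed (path_image (\<gamma> {u, v})) \<and>
        path_image (\<gamma> {u, v}) \<inter> {p u} \<noteq> {} \<and> path_image (\<gamma> {u, v}) \<inter> {p v} \<noteq> {} \<and>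
        (\<forall>w\<in>verts H - {u, v}. path_image (\<gamma> {u, v}) \<inter> {p w} = {})"
    proof (intro ballI case_prodI2)
      fix e u v assume "e \<in> arcs_ends H" "e = (u, v)"
      then have uv: "(u, v) \<in> arcs_ends H"
        by simp
      then have "arc (\<gamma> {u, v})" and im: "path_image (\<gamma> {u, v}) \<inter> p ` verts H = {p u, p v}"
        and "u \<in> verts H" "v \<in> verts H"
        using bspec[OF edge uv] assms(2) by auto
      have "p w \<notin> path_image (\<gamma> {u, v})" if w: "w \<in> verts H - {u, v}" for w
      proof
        assume "p w \<in> path_image (\<gamma> {u, v})"
        then have "p w = p u \<or> p w = p v"
          using im w by blast
        then show False
          using inj w \<open>u \<in> verts H\<close> \<open>v \<in> verts H\<close> by (auto dest: inj_onD)
      qed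
      moreover have "p u \<in> path_image (\<gamma> {u, v})" "p v \<in> path_image (\<gamma> {u, v})"
        using im by blast+
      ultimately show "path_connected (path_image (\<gamma> {u, v})) \<and> closed (path_image (\<gamma> {u, v})) \<and>
        path_image (\<gamma> {u, v}) \<inter> {p u} \<noteq> {} \<and> path_image (\<gamma> {u, v}) \<inter> {p v} \<noteq> {} \<and>
        (\<forall>w\<in>verts H - {u, v}. path_image (\<gamma> {u, v}) \<inter> {p w} = {})"
        using \<open>arc (\<gamma> {u, v})\<close> by (simp add: closed_arc_image arc_imp_path path_connected_path_image)
    qed
    have "\<Union> ((\<lambda>v. {p v}) ` S) = p ` S" for S
      by blast
    then show "\<forall>(u, v)\<in>arcs_ends H. \<forall>(x, y)\<in>arcs_ends H. {u, v} \<noteq> {x, y} \<longrightarrow>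
        path_image (\<gamma> {u, v}) \<inter> path_image (\<gamma> {x, y}) \<subseteq> \<Union> ((\<lambda>v. {p v}) ` ({u, v} \<inter> {x, y}))"
      using cross by simp
  qed
  then show ?thesis
    using assms by (auto simp: thickly_planar_def)
qed

section \<open>Edge deletion, degrees and the final count\<close>

definition delete_edge :: "'a pair_pre_digraph \<Rightarrow> 'a \<Rightarrow> 'a \<Rightarrow> 'a pair_pre_digraph" where
  "delete_edge G a b = \<lparr> pverts = pverts G, parcs = parcs G - {(a, b), (b, a)} \<rparr>"

lemma delete_edge_minor:
  assumes "simple_graph G"
  shows "is_minor (delete_edge G a b) G"
proof -
  interpret pair_graph G using assms by (simp add: simple_graph_def)
  have "sym (parcs G)"
    using pair_sym_arcs by (simp add: symmetric_def)
  then have "sym (parcs (delete_edge G a b))"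
    by (auto simp: delete_edge_def sym_def)
  then have "pair_graph (delete_edge G a b)"
    using arc_fst_in_verts arc_snd_in_verts pair_finite_verts pair_finite_arcs pair_no_loops
    by unfold_locales (auto simp: delete_edge_def symmetric_def)
  then interpret D: pair_graph "delete_edge G a b" .
  have "simple_graph (delete_edge G a b)"
    using assms D.pair_graph by (simp add: simple_graph_def delete_edge_def)
  moreover have "subgraph (with_proj (delete_edge G a b)) (with_proj G)"
    using wf_digraph D.wf_digraph by (intro subgraphI) (auto simp: delete_edge_def compatible_def)
  ultimately show ?thesis
    by (auto simp: is_minor_def)
qed

lemma MMNA_delete_edge:
  assumes "MMNA G" "(a, b) \<in> parcs G"
  obtains v where "v \<in> pverts G" "v \<noteq> a" "v \<noteq> b"
    "planar (pre_digraph.del_vert (with_proj (delete_edge G a b)) v)"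
proof -
  have G: "simple_graph G" "not_apex G"
    and minimal: "\<And>H. is_minor H G \<Longrightarrow> H \<noteq> G \<Longrightarrow> \<not> not_apex H"
    using assms(1) by (auto simp: MMNA_def)
  have "parcs (delete_edge G a b) \<noteq> parcs G"
    using assms(2) by (auto simp: delete_edge_def)
  then have "\<not> not_apex (delete_edge G a b)"
    using minimal delete_edge_minor[OF G(1)] by metis
  then obtain v where v: "v \<in> pverts G"
      "planar (pre_digraph.del_vert (with_proj (delete_edge G a b)) v)"
    by (auto simp: not_apex_def delete_edge_def)
  have "pre_digraph.del_vert (with_proj (delete_edge G a b)) v = pre_digraph.del_vert (with_proj G) v"
    if "v = a \<or> v = b"
    using that by (auto simp: pre_digraph.del_vert_def delete_edge_def with_proj_def)
  then have "v \<noteq> a" "v \<noteq> b"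
    using v G(2) by (auto simp: not_apex_def)
  then show ?thesis
    using that v by blast
qed

text \<open>The planar remainder has at most 6(n - 1) - 10 arcs; the deleted edge contributes at
  most 2 more and the vertex \<open>v\<close> twice its degree. Hence 14 = 16 - 2.\<close>

lemma card_arcs_apex:
  assumes "simple_graph G" "3 \<le> card (pverts G)" "v \<in> pverts G"
    and "planar (pre_digraph.del_vert (with_proj (delete_edge G a b)) v)"
  shows "card (parcs G) + 14 \<le> 6 * card (pverts G) + 2 * card (parcs G `` {v})"
proof -
  interpret pair_graph G using assms(1) by (simp add: simple_graph_def)
  define H where "H = pre_digraph.del_vert (with_proj (delete_edge G a b)) v"
  define R where "R = {(x, y) \<in> parcs G - {(a, b), (b, a)}. x \<noteq> v \<and> y \<noteq> v}"
  have H: "verts H = pverts G - {v}" "arcs_ends H = R"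
    unfolding H_def R_def arcs_ends_conv pre_digraph.del_vert_def delete_edge_def with_proj_def
    by force+
  have symG: "(y, x) \<in> parcs G" if "(x, y) \<in> parcs G" for x y
    using that arcs_symmetric by blast
  have "thickly_planar (pverts G - {v}) R"
    unfolding H[symmetric]
  proof (rule planar_thickly_planar)
    show "arcs_ends H \<subseteq> verts H \<times> verts H"
      unfolding H R_def using in_arcsD1 in_arcsD2 by blast
    show "sym (arcs_ends H)"
      unfolding H R_def sym_def using symG by blast
    show "irrefl (arcs_ends H)"
      unfolding H R_def irrefl_def using no_loops' by blast
  qed (use assms(4) pair_finite_verts in \<open>simp_all add: H(1), simp add: H_def\<close>)
  moreover have cV: "card (pverts G - {v}) + 1 = card (pverts G)"
    using assms(2,3) pair_finite_verts by simp
  ultimately have cR: "card R + 10 \<le> 6 * card (pverts G - {v})"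
    using assms(2) by (intro thickly_planar_card_arcs) linarith+
  have finN: "finite (parcs G `` {v})" and finR: "finite R"
    using pair_finite_arcs finite_subset[of R "parcs G"] by (auto simp: R_def)
  let ?e = "{(a, b), (b, a)}" and ?out = "{v} \<times> parcs G `` {v}" and ?in = "parcs G `` {v} \<times> {v}"
  have "parcs G \<subseteq> R \<union> ?e \<union> ?out \<union> ?in"
    using symG by (auto simp: R_def)
  then have "card (parcs G) \<le> card (R \<union> ?e \<union> ?out \<union> ?in)"
    using finN finR by (intro card_mono) auto
  moreover have "card ?e \<le> 2"
    using card_length[of "[(a, b), (b, a)]"] by simp
  moreover have "card ?out = card (parcs G `` {v})" "card ?in = card (parcs G `` {v})"
    unfolding card_cartesian_product by simp_all
  ultimately show ?thesis
    using card_Un_le[of "R \<union> ?e \<union> ?out" ?in] card_Un_le[of "R \<union> ?e" ?out] card_Un_le[of R ?e] cR cV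
    by linarith
qed

text \<open>If \<open>v\<close> had fewer neighbours than the connectivity, they would form a cut
  that isolates \<open>v\<close> from some further vertex.\<close>

lemma connectivity_le_degree:
  assumes "simple_graph G" "v \<in> pverts G"
  shows "connectivity G \<le> card (parcs G `` {v})"
proof (rule ccontr)
  interpret pair_graph G using assms(1) by (simp add: simple_graph_def)
  assume less: "\<not> ?thesis"
  define S where "S = parcs G `` {v}"
  have S: "S \<subseteq> pverts G" "v \<notin> S" "finite S"
    using in_arcsD2 no_loops' finite_Image[OF pair_finite_arcs] by (auto simp: S_def)
  have card: "card S < connectivity G" "connectivity G < card (pverts G)"
    using less connectivity_greatest(1)[OF assms(1)] by (auto simp: S_def)
  \<comment> \<open>There is a vertex to be separated from \<open>v\<close> because the
    connectivity, and so \<open>card S + 1\<close>, is below the number of vertices.\<close>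
  have "pverts G \<noteq> insert v S"
    using card S by auto
  then obtain x where x: "x \<in> pverts G" "x \<noteq> v" "x \<notin> S"
    using S(1) assms(2) by blast
  \<comment> \<open>Connectedness is defined as strong connectedness of the symmetric closure, so it
    is refuted by showing that \<open>v\<close> has no outgoing arc there.\<close>
  let ?M = "mk_symmetric (with_proj G \<restriction> (pverts G - S))"
  have isolated: "(v, w) \<notin> parcs ?M" for w
    using arcs_symmetric by (auto simp: parcs_mk_symmetric S_def)
  have "\<not> v \<rightarrow>\<^sup>*\<^bsub>with_proj ?M\<^esub> x"
  proof
    assume "v \<rightarrow>\<^sup>*\<^bsub>with_proj ?M\<^esub> x"
    then show False
      using pre_digraph.converse_reachable_cases[of "with_proj ?M" v x] x(2) isolated by auto
  qed
  then have "\<not> Digraph_Component.connected (with_proj G \<restriction> (pverts G - S))"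
    using x S(2) assms(2) by (auto simp: Digraph_Component.connected_def strongly_connected_def)
  then have "has_cut G (card S)"
    unfolding has_cut_def using S(1) x(1,3) by blast
  then show False
    using connectivity_greatest(2)[OF assms(1) card(1)] by blast
qed

theorem theorem4p4:
  fixes G :: "'a pair_pre_digraph"
  assumes "MMNA G"
  shows "connectivity G \<le> 5"
proof (rule ccontr)
  assume "\<not> connectivity G \<le> 5"
  then have con: "6 \<le> connectivity G"
    by simp
  have G: "simple_graph G"
    using assms by (simp add: MMNA_def)
  interpret pair_graph G using G by (simp add: simple_graph_def)
  have sub: "parcs G \<subseteq> pverts G \<times> pverts G"
    using in_arcsD1 in_arcsD2 by auto
  have deg: "6 \<le> card (parcs G `` {v})" if "v \<in> pverts G" for v
    using connectivity_le_degree[OF G that] con by linarith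
  have n: "3 \<le> card (pverts G)"
    using con connectivity_greatest(1)[OF G] by linarith
  have edge_at: "\<exists>b. (v, b) \<in> parcs G" if "v \<in> pverts G" for v
  proof (rule ccontr)
    assume "\<nexists>b. (v, b) \<in> parcs G"
    then have "parcs G `` {v} = {}"
      by blast
    then show False
      using deg[OF that] by simp
  qed
  obtain a where "a \<in> pverts G"
    using G by (auto simp: simple_graph_def)
  then obtain b where "(a, b) \<in> parcs G"
    using edge_at by blast
  then obtain v where v: "v \<in> pverts G"
      "planar (pre_digraph.del_vert (with_proj (delete_edge G a b)) v)"
    using MMNA_delete_edge[OF assms] by blast
  obtain c where "(v, c) \<in> parcs G"
    using edge_at[OF v(1)] by blast
  then obtain w where w: "w \<in> pverts G" "w \<noteq> v"
      "planar (pre_digraph.del_vert (with_proj (delete_edge G v c)) w)"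
    using MMNA_delete_edge[OF assms] by blast
  have V: "pverts G = insert v (insert w (pverts G - {v, w}))"
    using v(1) w(1) by blast
  have cV: "card (pverts G) = card (pverts G - {v, w}) + 2"
    using v(1) w(1,2) n pair_finite_verts by (simp add: card_Diff_subset)
  have "card (parcs G) = (\<Sum>x\<in>pverts G. card (parcs G `` {x}))"
    by (rule card_eq_sum_degrees[OF pair_finite_verts sub])
  also have "\<dots> = (\<Sum>x\<in>insert v (insert w (pverts G - {v, w})). card (parcs G `` {x}))"
    by (subst V[symmetric]) (rule refl)
  also have "\<dots> = card (parcs G `` {v}) + card (parcs G `` {w}) + (\<Sum>x\<in>pverts G - {v, w}. card (parcs G `` {x}))"
    using w(2) pair_finite_verts by simp
  finally have "card (parcs G) = card (parcs G `` {v}) + card (parcs G `` {w}) +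
    (\<Sum>x\<in>pverts G - {v, w}. card (parcs G `` {x}))" .
  moreover have "(\<Sum>x\<in>pverts G - {v, w}. 6) \<le> (\<Sum>x\<in>pverts G - {v, w}. card (parcs G `` {x}))"
    by (intro sum_mono) (use deg in auto)
  ultimately have "card (parcs G `` {v}) + card (parcs G `` {w}) + 6 * card (pverts G - {v, w}) \<le> card (parcs G)"
    by simp
  \<comment> \<open>In arcs, the two apex bounds add up to 2|R| + 28 \<le> 12n + 2 deg v + 2 deg w,
    while twice the degree sum gives 2|R| + 24 \<ge> 12n + 2 deg v + 2 deg w, where R is
    \<open>parcs G\<close>.\<close>
  then show False
    using card_arcs_apex[OF G n v] card_arcs_apex[OF G n w(1,3)] cV by linarith
qed

end
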